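(* Consider the varying-coefficient model with isotropic Gaussian process prior described in the context, with label space $\mathcal{Y}=\mathbb{R}$ and observation model $p(y\mid \mathbf{x},\mathbf{w})=\mathcal{N}(y\mid \mathbf{x}^{\mathsf T}\mathbf{w},\tau^2)$, where $\tau>0$. Let $\mathbf{x}_1,\dots,\mathbf{x}_n,\mathbf{x}_\star\in\mathcal{X}\subseteq\mathbb{R}^m$ be instances with task variables $\mathbf{t}_1,\dots,\mathbf{t}_n,\mathbf{t}_\star\in\mathcal{T}$, let $\mathbf{y}=(y_1,\dots,y_n)^{\mathsf T}\in\mathbb{R}^n$ be the observed training labels, and let the task kernel matrix $\mathbf{K}_{\mathbf{T}}=\big(k_{\mathcal{T}}(\mathbf{t}_i,\mathbf{t}_j)\big)_{i,j=1}^n$ be positive definite. Let $\mathbf{K}\in\mathbb{R}^{n\times n}$ be the matrix with components $k_{ij}=\mathbf{x}_i^{\mathsf T}\mathbf{x}_j\,k_{\mathcal{T}}(\mathbf{t}_i,\mathbf{t}_j)$ and let $\mathbf{k}\in\mathbb{R}^n$ be the vector with components $k_i=\mathbf{x}_i^{\mathsf T}\mathbf{x}_\star\,k_{\mathcal{T}}(\mathbf{t}_i,\mathbf{t}_\star)$. Then the predictive distribution of the label $y_\star$ of $\mathbf{x}_\star$ is $$p(y_\star\mid \mathbf{X},\mathbf{y},\mathbf{T},\mathbf{x}_\star,\mathbf{t}_\star)=\mathcal{N}(y_\star\mid \mu,\sigma^2+\tau^2),$$ where $$\mu=\mathbf{k}^{\mathsf T}(\mathbf{K}+\tau^2\mathbf{I}_{n\times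 n})^{-1}\mathbf{y},\qquad \sigma^2=\mathbf{x}_\star^{\mathsf T}\mathbf{x}_\star\,k_{\mathcal{T}}(\mathbf{t}_\star,\mathbf{t}_\star)-\mathbf{k}^{\mathsf T}(\mathbf{K}+\tau^2\mathbf{I}_{n\times n})^{-1}\mathbf{k}.$$
   Context: Notation: $\mathcal{N}(\cdot\mid\mu,v)$ is the normal density with mean $\mu$ and variance $v$; $\mathbf{I}_{m\times m}$ is the identity matrix; $\mathbf{X}\in\mathbb{R}^{n\times m}$ has rows $\mathbf{x}_1^{\mathsf T},\dots,\mathbf{x}_n^{\mathsf T}$; $\mathbf{T}$ collects $\mathbf{t}_1,\dots,\mathbf{t}_n$. Varying-coefficient model with isotropic Gaussian process prior: Let $\mathcal{T}$ be a set (of task variables) and $k_{\mathcal{T}}:\mathcal{T}\times\mathcal{T}\to\mathbb{R}$ a positive semidefinite kernel. The instances $\mathbf{x}_1,\dots,\mathbf{x}_n,\mathbf{x}_\star$ and task variables $\mathbf{t}_1,\dots,\mathbf{t}_n,\mathbf{t}_\star$ are fixed (non-random). A random function $\boldsymbol\omega:\mathcal{T}\to\mathbb{R}^m$ is drawn from the zero-mean vector-valued Gaussian process $\mathcal{GP}(\mathbf{0},\boldsymbol\kappa)$ with the isotropic matrix-valued kernel $\boldsymbol\kappa(\mathbf{t},\mathbf{t}')=k_{\mathcal{T}}(\mathbf{t},\mathbf{t}')\,\mathbf{I}_{m\times m}$, i.e. all finite-dimensional evaluations of $\boldsymbol\omega$ are jointly Gaussian with mean zero and $\mathrm{Cov}(\boldsymbol\omega(\mathbf{t})_s,\boldsymbol\omega(\mathbf{t}')_r)=\boldsymbol\kappa(\mathbf{t},\mathbf{t}')_{s,r}$.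 Set $\mathbf{w}_i=\boldsymbol\omega(\mathbf{t}_i)$ and $\mathbf{w}_\star=\boldsymbol\omega(\mathbf{t}_\star)$. Given $\boldsymbol\omega$, the labels are drawn independently as $y_i\sim p(y\mid\mathbf{x}_i,\mathbf{w}_i)$ for $i=1,\dots,n$ and $y_\star\sim p(y\mid\mathbf{x}_\star,\mathbf{w}_\star)$. The predictive distribution $p(y_\star\mid \mathbf{X},\mathbf{y},\mathbf{T},\mathbf{x}_\star,\mathbf{t}_\star)$ is the conditional density of $y_\star$ given $(y_1,\dots,y_n)=\mathbf{y}$ under this model; equivalently, the integral of $p(y_\star\mid\mathbf{x}_\star,\mathbf{w}_\star)$ against the posterior distribution of $\mathbf{w}_\star$ given the training labels $\mathbf{y}$. *)

theory Defs
  imports "HOL-Probability.Probability"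
begin

(* normal_density takes the standard deviation; here the second argument is the variance. *)
definition normal_pdf :: "real \<Rightarrow> real \<Rightarrow> real \<Rightarrow> real" where
  "normal_pdf \<mu> v y = normal_density \<mu> (sqrt v) y"

definition positive_definite :: "real^'n^'n \<Rightarrow> bool" where
  "positive_definite A \<longleftrightarrow> transpose A = A \<and> (\<forall>v. v \<noteq> 0 \<longrightarrow> v \<bullet> (A *v v) > 0)"

definition psd_kernel :: "'t set \<Rightarrow> ('t \<Rightarrow> 't \<Rightarrow> real) \<Rightarrow> bool" where
  "psd_kernel T k \<longleftrightarrow>
     (\<forall>s\<in>T. \<forall>t\<in>T. k s t = k t s) \<and>
     (\<forall>F c. finite F \<and> F \<subseteq> T \<longrightarrow> (\<Sum>s\<in>F. \<Sum>t\<in>F. c s * c t * k s t) \<ge> 0)"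

(* Point masses are included: covariance matrices need not be invertible. *)
definition gaussian_rv :: "'p measure \<Rightarrow> ('p \<Rightarrow> real) \<Rightarrow> bool" where
  "gaussian_rv M X \<longleftrightarrow> X \<in> borel_measurable M \<and>
     ((\<exists>\<mu>. AE p in M. X p = \<mu>) \<or>
      (\<exists>\<mu> \<sigma>. \<sigma> > 0 \<and> distributed M lborel X (normal_density \<mu> \<sigma>)))"

definition jointly_gaussian :: "'p measure \<Rightarrow> 'i set \<Rightarrow> ('i \<Rightarrow> 'p \<Rightarrow> real) \<Rightarrow> bool" where
  "jointly_gaussian M I Z \<longleftrightarrow> (\<forall>a. gaussian_rv M (\<lambda>p. \<Sum>i\<in>I. a i * Z i p))"

definition covariance :: "'p measure \<Rightarrow> ('p \<Rightarrow> real) \<Rightarrow> ('p \<Rightarrow> real) \<Rightarrow> real" where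
  "covariance M X Y =
     (\<integral>p. (X p - (\<integral>q. X q \<partial>M)) * (Y p - (\<integral>q. Y q \<partial>M)) \<partial>M)"

definition gaussian_process ::
  "'p measure \<Rightarrow> 't set \<Rightarrow> ('t \<Rightarrow> real^'m) \<Rightarrow> ('t \<Rightarrow> 't \<Rightarrow> real^'m^'m)
   \<Rightarrow> ('t \<Rightarrow> 'p \<Rightarrow> real^'m) \<Rightarrow> bool" where
  "gaussian_process M T \<mu> \<kappa> W \<longleftrightarrow>
     (\<forall>t\<in>T. W t \<in> borel_measurable M) \<and>
     (\<forall>F. finite F \<and> F \<subseteq> T \<longrightarrow>
        jointly_gaussian M (F \<times> UNIV) (\<lambda>(t, s) p. W t p $ s)) \<and>
     (\<forall>t\<in>T. \<forall>s. (\<integral>p. W t p $ s \<partial>M) = \<mu> t $ s) \<and>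
     (\<forall>t\<in>T. \<forall>t'\<in>T. \<forall>s r.
        covariance M (\<lambda>p. W t p $ s) (\<lambda>p. W t' p $ r) = \<kappa> t t' $ s $ r)"

definition isotropic_kernel :: "('t \<Rightarrow> 't \<Rightarrow> real) \<Rightarrow> 't \<Rightarrow> 't \<Rightarrow> real^'m^'m" where
  "isotropic_kernel k t t' = k t t' *\<^sub>R mat 1"

(* The sigma-algebra generated by the whole random function on T. *)
definition process_algebra :: "'p measure \<Rightarrow> 't set \<Rightarrow> ('t \<Rightarrow> 'p \<Rightarrow> real^'m) \<Rightarrow> 'p measure" where
  "process_algebra M T W =
     vimage_algebra (space M) (\<lambda>p. \<lambda>t\<in>T. W t p) (\<Pi>\<^sub>M t\<in>T. borel)"

(* obs x w y is the observation density p(y | x, w). Conditionally on the random function, the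
   labels Y $ i and Ys are independent with densities obs (X $ i) (W (t i)) and obs xs (W ts). *)
definition labels_given_process ::
  "'p measure \<Rightarrow> 't set \<Rightarrow> ('t \<Rightarrow> 'p \<Rightarrow> real^'m) \<Rightarrow> (real^'m \<Rightarrow> real^'m \<Rightarrow> real \<Rightarrow> real)
   \<Rightarrow> real^'m^'n \<Rightarrow> ('n \<Rightarrow> 't) \<Rightarrow> real^'m \<Rightarrow> 't \<Rightarrow> ('p \<Rightarrow> real^'n) \<Rightarrow> ('p \<Rightarrow> real) \<Rightarrow> bool" where
  "labels_given_process M T W obs X t xs ts Y Ys \<longleftrightarrow>
     Y \<in> borel_measurable M \<and> Ys \<in> borel_measurable M \<and>
     (\<forall>B Bs. (\<forall>i. B i \<in> sets borel) \<and> Bs \<in> sets borel \<longrightarrow>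
        (AE p in M.
           real_cond_exp M (process_algebra M T W)
             (indicator {q \<in> space M. (\<forall>i. Y q $ i \<in> B i) \<and> Ys q \<in> Bs}) p =
           (\<Prod>i\<in>UNIV. LINT y:B i|lborel. obs (X $ i) (W (t i) p) y) *
           (LINT y:Bs|lborel. obs xs (W ts p) y)))"

definition train_likelihood ::
  "('t \<Rightarrow> 'p \<Rightarrow> real^'m) \<Rightarrow> (real^'m \<Rightarrow> real^'m \<Rightarrow> real \<Rightarrow> real)
   \<Rightarrow> real^'m^'n \<Rightarrow> ('n \<Rightarrow> 't) \<Rightarrow> real^'n \<Rightarrow> 'p \<Rightarrow> real" where
  "train_likelihood W obs X t y p = (\<Prod>i\<in>UNIV. obs (X $ i) (W (t i) p) (y $ i))"

(* Posterior distribution of W ts given the training labels y, by Bayes' rule. *)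
definition posterior ::
  "'p measure \<Rightarrow> ('t \<Rightarrow> 'p \<Rightarrow> real^'m) \<Rightarrow> (real^'m \<Rightarrow> real^'m \<Rightarrow> real \<Rightarrow> real)
   \<Rightarrow> real^'m^'n \<Rightarrow> ('n \<Rightarrow> 't) \<Rightarrow> 't \<Rightarrow> real^'n \<Rightarrow> (real^'m) measure" where
  "posterior M W obs X t ts y =
     distr
       (density M (\<lambda>p. ennreal (train_likelihood W obs X t y p /
                                 (\<integral>q. train_likelihood W obs X t y q \<partial>M))))
       borel (W ts)"

definition predictive_density ::
  "'p measure \<Rightarrow> ('t \<Rightarrow> 'p \<Rightarrow> real^'m) \<Rightarrow> (real^'m \<Rightarrow> real^'m \<Rightarrow> real \<Rightarrow> real)
   \<Rightarrow> real^'m^'n \<Rightarrow> ('n \<Rightarrow> 't) \<Rightarrow> real^'m \<Rightarrow> 't \<Rightarrow> real^'n \<Rightarrow> real \<Rightarrow> real" where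
  "predictive_density M W obs X t xs ts y v =
     (\<integral>w. obs xs w v \<partial>posterior M W obs X t ts y)"

(* f y is a density of Z conditionally on Y = y. Conditional densities are determined only up to
   null sets of Y; the requirement is that f integrates to a version of the conditional law. *)
definition conditional_density ::
  "'p measure \<Rightarrow> ('p \<Rightarrow> real^'n) \<Rightarrow> ('p \<Rightarrow> real) \<Rightarrow> (real^'n \<Rightarrow> real \<Rightarrow> real) \<Rightarrow> bool" where
  "conditional_density M Y Z f \<longleftrightarrow>
     (\<lambda>(y, v). f y v) \<in> borel_measurable (borel \<Otimes>\<^sub>M borel) \<and>
     (\<forall>y v. f y v \<ge> 0) \<and>
     (\<forall>y. (\<integral>\<^sup>+ v. ennreal (f y v) \<partial>lborel) = 1) \<and>
     (\<forall>B\<in>sets borel. AE p in M.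
        real_cond_exp M (vimage_algebra (space M) Y borel)
          (indicator {q \<in> space M. Z q \<in> B}) p =
        (LINT v:B|lborel. f (Y p) v))"

end

theory Submission
  imports Defs
begin

text \<open>
  Put \<open>f\<^sub>i = x\<^sub>i \<bullet> W(t\<^sub>i)\<close> and \<open>g = x\<^sub>* \<bullet> W(t\<^sub>*)\<close>; these are centered and jointly Gaussian, possibly
  degenerate, so they are handled through \<open>E exp(i(\<theta> \<bullet> f + \<phi> g))\<close> only. The joint density of the
  labels is \<open>E[\<Prod>\<^sub>i N(y\<^sub>i | f\<^sub>i, \<tau>\<^sup>2) N(v | g, \<tau>\<^sup>2)]\<close>. Writing each normal density as a Fourier
  integral and exchanging it with the expectation gives an integral of the exponential of a quadratic
  form in \<open>(\<theta>, \<phi>)\<close>. With \<open>b = (K + \<tau>\<^sup>2 I)\<^sup>-\<^sup>1 k\<close>, the translation \<open>\<theta> \<mapsto> \<theta> - \<phi> b\<close> removes the cross term,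
  and the integral splits as \<open>E[\<Prod>\<^sub>i N(y\<^sub>i | f\<^sub>i, \<tau>\<^sup>2)] N(v | b \<bullet> y, \<sigma>\<^sup>2 + \<tau>\<^sup>2)\<close>; no determinant is ever needed.
\<close>

section \<open>Lebesgue measure on \<open>real^'n\<close> as a product measure\<close>

lemma borel_measurable_vec_nth [measurable (raw)]:
  fixes f :: "'a \<Rightarrow> real^'n"
  assumes "f \<in> borel_measurable M"
  shows "(\<lambda>x. f x $ i) \<in> borel_measurable M"
  unfolding cart_eq_inner_axis using assms by measurable

lemma borel_measurable_vec_lambda:
  fixes f :: "'a \<Rightarrow> 'n::finite \<Rightarrow> real"
  assumes "\<And>i. (\<lambda>x. f x i) \<in> borel_measurable M"
  shows "(\<lambda>x. \<chi> i. f x i) \<in> borel_measurable M"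
  by (rule borel_measurable_euclidean_space[THEN iffD2])
     (auto simp: Basis_vec_def inner_axis assms)

lemma measurable_vec_lambda_PiM [measurable]:
  "vec_lambda \<in> borel_measurable (\<Pi>\<^sub>M i\<in>(UNIV::'n::finite set). (lborel :: real measure))"
  by (rule borel_measurable_vec_lambda) measurable

text \<open>Lebesgue measure is determined by its values on open boxes, and
  \<open>vec_lambda\<close> pulls a box back to a product of intervals. This reduces integrals of
  coordinatewise products to products of one-dimensional integrals.\<close>

lemma lborel_vec_eq:
  "(lborel :: (real^'n) measure) =
     distr (\<Pi>\<^sub>M i\<in>(UNIV::'n set). lborel) borel vec_lambda"
proof (rule lborel_eqI)
  interpret product_sigma_finite "\<lambda>i::'n. lborel :: real measure"
    by standard
  fix l u :: "real^'n"
  assume le: "\<And>b. b \<in> Basis \<Longrightarrow> l \<bullet> b \<le> u \<bullet> b"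
  have le': "l $ i \<le> u $ i" for i
    using le[of "axis i 1"] by (simp add: axis_in_Basis_iff inner_axis)
  have "vec_lambda -` box l u \<inter> space (\<Pi>\<^sub>M i\<in>(UNIV::'n set). (lborel :: real measure))
      = (\<Pi>\<^sub>E i\<in>UNIV. {l $ i<..<u $ i})"
    by (auto simp: mem_box_cart space_PiM PiE_iff)
  then have "emeasure (distr (\<Pi>\<^sub>M i\<in>(UNIV::'n set). lborel) borel vec_lambda) (box l u)
      = (\<Prod>i\<in>UNIV. ennreal (u $ i - l $ i))"
    by (subst emeasure_distr[OF measurable_vec_lambda_PiM]) (auto simp: emeasure_PiM le')
  also have "\<dots> = ennreal (\<Prod>i\<in>UNIV. u $ i - l $ i)"
    by (rule prod_ennreal) (simp add: le')
  also have "(\<Prod>i\<in>UNIV. u $ i - l $ i) = (\<Prod>b\<in>Basis. (u - l) \<bullet> b)"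
  proof -
    have B: "(Basis :: (real^'n) set) = (\<lambda>i. axis i 1) ` UNIV"
      by (auto simp: Basis_vec_def)
    show ?thesis
      unfolding B by (subst prod.reindex) (auto simp: inj_on_def axis_eq_axis inner_axis)
  qed
  finally show "emeasure (distr (\<Pi>\<^sub>M i\<in>(UNIV::'n set). lborel) borel vec_lambda) (box l u)
      = (\<Prod>b\<in>Basis. (u - l) \<bullet> b)" .
qed simp

lemma nn_integral_lborel_vec_prod:
  fixes f :: "'n::finite \<Rightarrow> real \<Rightarrow> ennreal"
  assumes [measurable]: "\<And>i. f i \<in> borel_measurable borel"
  shows "(\<integral>\<^sup>+x. (\<Prod>i\<in>UNIV. f i (x $ i)) \<partial>(lborel :: (real^'n) measure))
       = (\<Prod>i\<in>UNIV. \<integral>\<^sup>+x. f i x \<partial>lborel)"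
proof -
  interpret product_sigma_finite "\<lambda>i::'n. lborel :: real measure"
    by standard
  show ?thesis
    by (subst lborel_vec_eq, subst nn_integral_distr) (simp_all add: product_nn_integral_prod)
qed

lemma
  fixes f :: "'n::finite \<Rightarrow> real \<Rightarrow> complex"
  assumes int: "\<And>i. integrable lborel (f i)"
  shows integrable_lborel_vec_prod:
      "integrable (lborel :: (real^'n) measure) (\<lambda>x. \<Prod>i\<in>UNIV. f i (x $ i))"
    and integral_lborel_vec_prod:
      "(\<integral>x. (\<Prod>i\<in>UNIV. f i (x $ i)) \<partial>(lborel :: (real^'n) measure))
       = (\<Prod>i\<in>UNIV. \<integral>x. f i x \<partial>lborel)"
proof -
  interpret product_sigma_finite "\<lambda>i::'n. lborel :: real measure"
    by standard
  have [measurable]: "f i \<in> borel_measurable borel" for i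
    using borel_measurable_integrable[OF int, of i] by simp
  show "integrable (lborel :: (real^'n) measure) (\<lambda>x. \<Prod>i\<in>UNIV. f i (x $ i))"
    by (subst lborel_vec_eq, subst integrable_distr_eq) (simp_all add: product_integrable_prod int)
  show "(\<integral>x. (\<Prod>i\<in>UNIV. f i (x $ i)) \<partial>(lborel :: (real^'n) measure))
       = (\<Prod>i\<in>UNIV. \<integral>x. f i x \<partial>lborel)"
    by (subst lborel_vec_eq, subst integral_distr) (simp_all add: product_integral_prod int)
qed

section \<open>Fourier transforms of Gaussians on the line\<close>

lemma integral_lborel_translate:
  fixes f :: "'a::euclidean_space \<Rightarrow> 'b::{banach, second_countable_topology}"
  assumes [measurable]: "f \<in> borel_measurable borel"
  shows "(\<integral>x. f (c + x) \<partial>lborel) = (\<integral>x. f x \<partial>lborel)"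
  by (subst (2) lborel_distr_plus[symmetric, of c], subst integral_distr) simp_all

lemma iexp_add: "iexp (x + y) = iexp x * iexp y"
  by (simp add: exp_add ring_distribs)

text \<open>The substitution \<open>x = \<sigma> * x'\<close> turns the integral into the
  characteristic function of the standard normal law at \<open>\<sigma> * z\<close>.\<close>

lemma
  assumes [arith]: "\<sigma> > 0"
  shows integrable_normal_iexp: "integrable lborel (\<lambda>x. normal_density 0 \<sigma> x * iexp (x * z))"
    and integral_normal_iexp:
      "(CLBINT x. normal_density 0 \<sigma> x * iexp (x * z)) = complex_of_real (exp (- (\<sigma>\<^sup>2 * z\<^sup>2) / 2))"
proof -
  have "integrable lborel (\<lambda>x. complex_of_real (normal_density 0 \<sigma> x))"
    by simp
  then show "integrable lborel (\<lambda>x. normal_density 0 \<sigma> x * iexp (x * z))"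
    by (rule Bochner_Integration.integrable_bound) (auto simp: norm_mult)
  have "(CLBINT x. normal_density 0 \<sigma> x * iexp (x * z))
      = \<bar>\<sigma>\<bar> *\<^sub>R (CLBINT x. normal_density 0 \<sigma> (0 + \<sigma> * x) * iexp ((0 + \<sigma> * x) * z))"
    by (rule lborel_integral_real_affine) simp
  also have "\<dots> = (CLBINT x. std_normal_density x * iexp ((\<sigma> * z) * x))"
    by (subst integral_scaleR_right[symmetric])
       (intro Bochner_Integration.integral_cong,
        auto simp: normal_density_def real_sqrt_mult power_mult_distrib scaleR_conv_of_real mult_ac)
  also have "\<dots> = char std_normal_distribution (\<sigma> * z)"
    unfolding char_def by (subst integral_density) (auto simp: scaleR_conv_of_real)
  finally show "(CLBINT x. normal_density 0 \<sigma> x * iexp (x * z)) = complex_of_real (exp (- (\<sigma>\<^sup>2 * z\<^sup>2) / 2))"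
    by (simp add: char_std_normal_distribution power_mult_distrib exp_of_real)
qed

text \<open>Fourier inversion for the normal density: up to a constant the Gaussian in
  \<open>\<theta>\<close> is itself a normal density with standard deviation
  \<open>1 / sqrt s\<close>, so the preceding transform applies to it.\<close>

lemma
  assumes [arith]: "s > 0"
  shows integrable_gauss_iexp: "integrable lborel (\<lambda>\<theta>. complex_of_real (exp (- (s * \<theta>\<^sup>2) / 2)) * iexp (\<theta> * z))"
    and integral_gauss_iexp:
      "(CLBINT \<theta>. complex_of_real (exp (- (s * \<theta>\<^sup>2) / 2)) * iexp (\<theta> * z)) = 2 * pi * normal_density 0 (sqrt s) z"
proof -
  have dens: "exp (- (s * \<theta>\<^sup>2) / 2) = sqrt (2 * pi / s) * normal_density 0 (1 / sqrt s) \<theta>" for \<theta>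
    by (simp add: normal_density_def power_divide field_simps real_sqrt_mult real_sqrt_divide)
  \<comment> \<open>Splits the constant into the Fourier factor \<open>2 * pi\<close> and the
    normalising constant of the density of variance \<open>s\<close>.\<close>
  have sq: "sqrt (2 * pi / s) = 2 * pi / sqrt (2 * pi * s)"
    by (simp add: real_sqrt_divide real_sqrt_mult field_simps)
  show "integrable lborel (\<lambda>\<theta>. complex_of_real (exp (- (s * \<theta>\<^sup>2) / 2)) * iexp (\<theta> * z))"
    using integrable_mult_right[OF integrable_normal_iexp[of "1 / sqrt s" z], of "sqrt (2 * pi / s)"]
    unfolding dens by (simp add: mult_ac)
  have "(CLBINT \<theta>. complex_of_real (exp (- (s * \<theta>\<^sup>2) / 2)) * iexp (\<theta> * z))
     = (CLBINT \<theta>. sqrt (2 * pi / s) * (normal_density 0 (1 / sqrt s) \<theta> * iexp (\<theta> * z)))"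
    unfolding dens by (simp add: mult_ac)
  also have "\<dots> = sqrt (2 * pi / s) * complex_of_real (exp (- ((1 / sqrt s)\<^sup>2 * z\<^sup>2) / 2))"
    by (subst integral_mult_right_zero, subst integral_normal_iexp) auto
  also have "\<dots> = 2 * pi * normal_density 0 (sqrt s) z"
    by (simp add: sq normal_density_def power_divide field_simps real_sqrt_divide real_sqrt_mult
        flip: of_real_mult of_real_divide)
  finally show "(CLBINT \<theta>. complex_of_real (exp (- (s * \<theta>\<^sup>2) / 2)) * iexp (\<theta> * z)) = 2 * pi * normal_density 0 (sqrt s) z" .
qed

section \<open>Characteristic functions and the exchange with the expectation\<close>

text \<open>A point mass with mean zero sits at 0, where both sides of the formula equal 1;
  otherwise the transform of the normal density gives it. Stated through the second moment, the
  formula covers degenerate and nondegenerate variables alike.\<close>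

lemma (in prob_space) gaussian_rv_centered:
  assumes gauss: "gaussian_rv M Z" and mean: "expectation Z = 0"
  shows "integrable M (\<lambda>p. (Z p)\<^sup>2)"
    and "(CLINT p|M. iexp (Z p)) = complex_of_real (exp (- expectation (\<lambda>p. (Z p)\<^sup>2) / 2))"
proof -
  have [measurable]: "Z \<in> borel_measurable M"
    using gauss by (simp add: gaussian_rv_def)
  consider (const) m where "AE p in M. Z p = m"
    | (normal) m \<sigma> where "\<sigma> > 0" "distributed M lborel Z (normal_density m \<sigma>)"
    using gauss unfolding gaussian_rv_def by blast
  then have "integrable M (\<lambda>p. (Z p)\<^sup>2) \<and>
    (CLINT p|M. iexp (Z p)) = complex_of_real (exp (- expectation (\<lambda>p. (Z p)\<^sup>2) / 2))"
  proof cases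
    case const
    have "expectation Z = expectation (\<lambda>_. m)"
      using const by (intro integral_cong_AE) auto
    then have AE0: "AE p in M. Z p = 0"
      using const mean by (simp add: prob_space)
    have "integrable M (\<lambda>p. (Z p)\<^sup>2)"
      by (subst integrable_cong_AE[where g = "\<lambda>_. 0"]) (use AE0 in auto)
    moreover have "expectation (\<lambda>p. (Z p)\<^sup>2) = expectation (\<lambda>_. 0)"
      using AE0 by (intro integral_cong_AE) auto
    moreover have "(CLINT p|M. iexp (Z p)) = (CLINT p|M. 1)"
      using AE0 by (intro integral_cong_AE) auto
    ultimately show ?thesis
      by (simp add: prob_space)
  next
    case normal
    then have m: "m = 0"
      using normal_distributed_expectation mean by metis
    have "integrable lborel (\<lambda>x. normal_density 0 \<sigma> x * x\<^sup>2)"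
      using integrable_normal_moment[of \<sigma> 0 2] normal(1) by simp
    then have "integrable M (\<lambda>p. (Z p)\<^sup>2)"
      using distributed_integrable[OF normal(2), of "\<lambda>x. x\<^sup>2"] m by simp
    moreover have "expectation (\<lambda>p. (Z p)\<^sup>2) = \<sigma>\<^sup>2"
      using normal_distributed_variance[OF normal] mean by simp
    moreover have "(CLINT p|M. iexp (Z p)) = complex_of_real (exp (- \<sigma>\<^sup>2 / 2))"
    proof -
      have "(CLINT p|M. iexp (Z p)) = (CLINT x|distr M lborel Z. iexp x)"
        by (subst integral_distr) auto
      also have "\<dots> = (CLINT x|density lborel (normal_density 0 \<sigma>). iexp x)"
        using distributed_distr_eq_density[OF normal(2)] m by simp
      also have "\<dots> = (CLBINT x. normal_density 0 \<sigma> x * iexp (x * 1))"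
        by (subst integral_density) (auto simp: scaleR_conv_of_real)
      finally show ?thesis
        using integral_normal_iexp[OF normal(1), of 1] by simp
    qed
    ultimately show ?thesis
      by simp
  qed
  then show "integrable M (\<lambda>p. (Z p)\<^sup>2)"
    and "(CLINT p|M. iexp (Z p)) = complex_of_real (exp (- expectation (\<lambda>p. (Z p)\<^sup>2) / 2))"
    by auto
qed

text \<open>The exponential has modulus one, so the integrand is dominated by
  \<open>C * norm (G \<theta>)\<close>, which is integrable on the product because \<open>M\<close>
  is a probability measure; Fubini then applies. The bounded weight \<open>u\<close> allows two
  uses: over the training frequencies with \<open>u\<close> a character of \<open>g\<close>, and
  over the test frequency with \<open>u\<close> the training likelihood.\<close>

lemma (in prob_space) expectation_fourier:
  fixes f :: "'a \<Rightarrow> 'b::euclidean_space" and u :: "'a \<Rightarrow> complex" and G :: "'b \<Rightarrow> complex"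
  assumes [measurable]: "f \<in> borel_measurable M" "u \<in> borel_measurable M"
    and bound: "\<And>p. norm (u p) \<le> C"
    and G: "integrable lborel G"
  shows "(CLINT p|M. u p * (CLINT \<theta>|lborel. G \<theta> * iexp (\<theta> \<bullet> (y - f p))))
       = (CLINT \<theta>|lborel. G \<theta> * iexp (\<theta> \<bullet> y) * (CLINT p|M. u p * iexp (- (\<theta> \<bullet> f p))))"
proof -
  interpret pair_sigma_finite M lborel ..
  have [measurable]: "G \<in> borel_measurable borel"
    using borel_measurable_integrable[OF G] by simp
  let ?F = "\<lambda>p \<theta>. u p * (G \<theta> * iexp (\<theta> \<bullet> (y - f p)))"
  have nrm: "norm (?F p \<theta>) = norm (u p) * norm (G \<theta>)" for p \<theta>
    by (simp add: norm_mult)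
  have int1: "integrable lborel (?F p)" for p
  proof (rule Bochner_Integration.integrable_bound)
    show "integrable lborel (\<lambda>\<theta>. norm (u p) * norm (G \<theta>))"
      by (intro integrable_mult_right integrable_norm G)
  qed (auto simp: nrm)
  have int: "integrable (M \<Otimes>\<^sub>M lborel) (case_prod ?F)"
  proof (rule Fubini_integrable)
    have "integrable M (\<lambda>p. norm (u p) * (LBINT \<theta>. norm (G \<theta>)))"
      using bound by (intro integrable_mult_left integrable_const_bound[of _ C]) auto
    then show "integrable M (\<lambda>p. LBINT \<theta>. norm (case (p, \<theta>) of (p, \<theta>) \<Rightarrow> ?F p \<theta>))"
      by (simp add: nrm del: norm_mult)
  qed (use int1 in auto)
  have "(CLINT p|M. u p * (CLINT \<theta>|lborel. G \<theta> * iexp (\<theta> \<bullet> (y - f p))))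
      = (CLINT p|M. CLINT \<theta>|lborel. ?F p \<theta>)"
    by simp
  also have "\<dots> = (CLINT \<theta>|lborel. CLINT p|M. ?F p \<theta>)"
    by (rule Fubini_integral[OF int, symmetric])
  also have "\<dots> = (CLINT \<theta>|lborel. CLINT p|M. G \<theta> * iexp (\<theta> \<bullet> y) * (u p * iexp (- (\<theta> \<bullet> f p))))"
    by (intro Bochner_Integration.integral_cong refl)
       (simp add: inner_diff_right right_diff_distrib exp_diff exp_minus field_simps)
  finally show ?thesis
    by simp
qed

text \<open>Both \<open>\<theta> \<bullet> \<theta>\<close> and \<open>\<theta> \<bullet> z\<close>
  are sums over coordinates, so the integrand is a product of one-dimensional ones. Integrability of
  the Gaussian alone is the case of \<open>z = 0\<close>.\<close>

lemma gauss_vec_fourier: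
  assumes "\<tau> > 0"
  shows "integrable lborel (\<lambda>\<theta>::real^'n. complex_of_real (exp (- (\<tau>\<^sup>2 * (\<theta> \<bullet> \<theta>)) / 2)))"
    and "(CLINT \<theta>|lborel. complex_of_real (exp (- (\<tau>\<^sup>2 * (\<theta> \<bullet> \<theta>)) / 2)) * iexp (\<theta> \<bullet> z))
      = (2 * pi) ^ CARD('n) * (\<Prod>i\<in>UNIV. normal_density 0 \<tau> ((z :: real^'n) $ i))"
proof -
  define F where "F \<theta> x = complex_of_real (exp (- (\<tau>\<^sup>2 * \<theta>\<^sup>2) / 2)) * iexp (\<theta> * x)" for \<theta> x
  have \<tau>2: "\<tau>\<^sup>2 > 0" "sqrt (\<tau>\<^sup>2) = \<tau>"
    using assms by auto
  have int: "integrable lborel (\<lambda>\<theta>. F \<theta> x)" for x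
    unfolding F_def by (rule integrable_gauss_iexp[OF \<tau>2(1)])
  have prod: "(\<Prod>i\<in>UNIV. F (\<theta> $ i) (x $ i))
      = complex_of_real (exp (- (\<tau>\<^sup>2 * (\<theta> \<bullet> \<theta>)) / 2)) * iexp (\<theta> \<bullet> x)" for \<theta> x :: "real^'n"
    unfolding F_def inner_vec_def
    by (simp add: prod.distrib sum_distrib_left sum_negf power2_eq_square sum_divide_distrib
             flip: of_real_prod exp_of_real exp_sum)
  show "integrable lborel (\<lambda>\<theta>::real^'n. complex_of_real (exp (- (\<tau>\<^sup>2 * (\<theta> \<bullet> \<theta>)) / 2)))"
    using integrable_lborel_vec_prod[of "\<lambda>_::'n. \<lambda>\<theta>. F \<theta> 0", OF int] prod[of _ 0] by simp
  have "(CLINT \<theta>|lborel. complex_of_real (exp (- (\<tau>\<^sup>2 * (\<theta> \<bullet> \<theta>)) / 2)) * iexp (\<theta> \<bullet> z))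
      = (\<Prod>i\<in>UNIV. CLBINT \<theta>. F \<theta> (z $ i))"
    unfolding prod[symmetric] by (rule integral_lborel_vec_prod) (rule int)
  also have "\<dots> = (\<Prod>i\<in>UNIV. complex_of_real (2 * pi * normal_density 0 \<tau> (z $ i)))"
    unfolding F_def integral_gauss_iexp[OF \<tau>2(1)] \<tau>2(2) ..
  finally show "(CLINT \<theta>|lborel. complex_of_real (exp (- (\<tau>\<^sup>2 * (\<theta> \<bullet> \<theta>)) / 2)) * iexp (\<theta> \<bullet> z))
      = (2 * pi) ^ CARD('n) * (\<Prod>i\<in>UNIV. normal_density 0 \<tau> (z $ i))"
    by (simp add: prod.distrib)
qed

lemma normal_density_le:
  assumes "\<tau> > 0"
  shows "normal_density \<mu> \<tau> z \<le> 1 / sqrt (2 * pi * \<tau>\<^sup>2)"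
  using assms by (auto simp: normal_density_def intro!: divide_right_mono)

lemma prod_normal_density_le:
  assumes "\<tau> > 0"
  shows "(\<Prod>i\<in>I. normal_density (\<mu> i) \<tau> (z i)) \<le> (1 / sqrt (2 * pi * \<tau>\<^sup>2)) ^ card I"
  using prod_mono[of I "\<lambda>i. normal_density (\<mu> i) \<tau> (z i)" "\<lambda>_. 1 / sqrt (2 * pi * \<tau>\<^sup>2)"]
    normal_density_le[OF assms] by (simp add: normal_density_nonneg)

text \<open>The mean of a function of modulus one has modulus at most one. This yields positive
  semidefiniteness directly from the characteristic function.\<close>

lemma (in prob_space) char_exponent_nonneg:
  assumes [measurable]: "Z \<in> borel_measurable M"
    and char: "(CLINT p|M. iexp (Z p)) = complex_of_real (exp (- q / 2))"
  shows "q \<ge> 0"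
proof -
  have "norm (CLINT p|M. iexp (Z p)) \<le> (LINT p|M. norm (iexp (Z p)))"
    by (rule integral_norm_bound)
  then have "exp (- q / 2) \<le> 1"
    unfolding char by (simp add: prob_space del: of_real_exp)
  then show ?thesis
    by simp
qed

section \<open>Inverting the regularised kernel matrix\<close>

text \<open>If \<open>A *v x = 0\<close>, then pairing with \<open>x\<close> gives two nonnegative
  terms with sum 0, and \<open>r > 0\<close> forces \<open>x = 0\<close>. The inverse inherits
  symmetry from \<open>A\<close>: write each vector as \<open>A\<close> applied to its image under
  the inverse.\<close>

lemma psd_plus_scaled_identity:
  fixes K :: "real^'n^'n"
  assumes psd: "\<And>\<theta>. \<theta> \<bullet> (K *v \<theta>) \<ge> 0" and sym: "transpose K = K" and r: "r > 0"
  defines "A \<equiv> K + r *\<^sub>R mat 1"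
  shows "invertible A"
    and "K *v (matrix_inv A *v z) + r *\<^sub>R (matrix_inv A *v z) = z"
    and "x \<bullet> (matrix_inv A *v z) = (matrix_inv A *v x) \<bullet> z"
proof -
  have A: "A *v x = K *v x + r *\<^sub>R x" for x
    by (simp add: A_def matrix_vector_mult_add_rdistrib scaleR_matrix_vector_assoc[symmetric])
  have "x = 0" if "A *v x = 0" for x
  proof -
    have "x \<bullet> (K *v x) + r * (x \<bullet> x) = 0"
      using arg_cong[OF that, of "\<lambda>z. x \<bullet> z"] by (simp add: A inner_add_right)
    moreover have "r * (x \<bullet> x) \<ge> 0"
      using r by simp
    ultimately have "r * (x \<bullet> x) = 0"
      using psd[of x] by linarith
    then show "x = 0"
      using r by simp
  qed
  then have "\<exists>B. B ** A = mat 1"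
    by (subst matrix_left_invertible_ker) blast
  then show inv: "invertible A"
    by (simp add: invertible_left_inverse)
  \<comment> \<open>\<open>matrix_inv\<close> is a choice among two-sided inverses, so invertibility
    provides its defining property.\<close>
  have AA: "A *v (matrix_inv A *v z) = z" for z
    using someI_ex[OF inv[unfolded invertible_def]]
    by (simp add: matrix_inv_def matrix_vector_mul_assoc)
  then show "K *v (matrix_inv A *v z) + r *\<^sub>R (matrix_inv A *v z) = z"
    by (simp add: A)
  have "transpose A = A"
    using sym by (auto simp: A_def transpose_def vec_eq_iff mat_def)
  then have "x \<bullet> (A *v z) = (A *v x) \<bullet> z" for x z
    by (metis dot_lmul_matrix vector_transpose_matrix)
  then show "x \<bullet> (matrix_inv A *v z) = (matrix_inv A *v x) \<bullet> z"
    by (metis AA)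
qed

section \<open>Factorisation of the joint label density\<close>

text \<open>Here \<open>K\<close>, \<open>kv\<close> and \<open>c\<close> are the covariance of
  \<open>f\<close>, the cross-covariance with \<open>g\<close> and the variance of \<open>g\<close>;
  \<open>b\<close> enters only through its linear equation. Since the law of \<open>(f, g)\<close>
  is given by its characteristic function, it may be singular.\<close>

lemma (in prob_space) gaussian_smoothing_factor:
  fixes f :: "'a \<Rightarrow> real^'n" and g :: "'a \<Rightarrow> real" and K :: "real^'n^'n"
  assumes [measurable]: "f \<in> borel_measurable M" "g \<in> borel_measurable M"
    and \<tau>: "\<tau> > 0" and s: "s > 0" "s = c - kv \<bullet> b + \<tau>\<^sup>2"
    and sym: "transpose K = K"
    and b: "K *v b + \<tau>\<^sup>2 *\<^sub>R b = kv"
    and char: "\<And>\<theta> \<phi>. (CLINT p|M. iexp (\<theta> \<bullet> f p + \<phi> * g p)) =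
      complex_of_real (exp (- (\<theta> \<bullet> (K *v \<theta>) + 2 * \<phi> * (\<theta> \<bullet> kv) + \<phi>\<^sup>2 * c) / 2))"
  shows "(LINT p|M. (\<Prod>i\<in>UNIV. normal_density (f p $ i) \<tau> (y $ i)) * normal_density (g p) \<tau> v)
    = (LINT p|M. (\<Prod>i\<in>UNIV. normal_density (f p $ i) \<tau> (y $ i))) * normal_density (b \<bullet> y) (sqrt s) v"
proof -
  define D where "D p = (\<Prod>i\<in>UNIV. normal_density (f p $ i) \<tau> (y $ i))" for p
  define G where "G \<theta> = complex_of_real (exp (- (\<tau>\<^sup>2 * (\<theta> \<bullet> \<theta>)) / 2))" for \<theta> :: "real^'n"
  define G1 where "G1 \<phi> = complex_of_real (exp (- (\<tau>\<^sup>2 * \<phi>\<^sup>2) / 2))" for \<phi> :: real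
  define R where "R \<theta> = iexp (\<theta> \<bullet> y) *
    complex_of_real (exp (- (\<theta> \<bullet> (K *v \<theta>) + \<tau>\<^sup>2 * (\<theta> \<bullet> \<theta>)) / 2))" for \<theta> :: "real^'n"
  \<comment> \<open>\<open>H\<close> is the Fourier transform of \<open>g\<close> weighted by the
    training likelihood. The goal is \<open>H \<phi> = E \<phi> * H 0\<close>, where
    \<open>E\<close> is the transform of a Gaussian with mean \<open>b \<bullet> y\<close> and
    variance \<open>c - kv \<bullet> b\<close>.\<close>
  define H where "H \<phi> = (CLINT p|M. complex_of_real (D p) * iexp (- (\<phi> * g p)))" for \<phi>
  define E where "E \<phi> = iexp (- (\<phi> * (b \<bullet> y))) *
    complex_of_real (exp (- (\<phi>\<^sup>2 * (c - kv \<bullet> b)) / 2))" for \<phi>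
  let ?N = "(2 * pi) ^ CARD('n) :: complex"
  have \<tau>2: "\<tau>\<^sup>2 > 0" "sqrt (\<tau>\<^sup>2) = \<tau>"
    using \<tau> by auto
  have [measurable]: "D \<in> borel_measurable M"
    unfolding D_def normal_density_def by measurable
  have shift0: "normal_density m r x = normal_density 0 r (x - m)" for m r x
    by (simp add: normal_density_def)
  have D: "(CLINT \<theta>|lborel. G \<theta> * iexp (\<theta> \<bullet> (y - f p))) = ?N * D p" for p
    unfolding G_def D_def using gauss_vec_fourier(2)[OF \<tau>, of "y - f p"]
    by (simp add: shift0[of "f p $ i" for i])
  have K_sym: "x \<bullet> (K *v z) = z \<bullet> (K *v x)" for x z
    by (metis sym dot_lmul_matrix vector_transpose_matrix inner_commute)
  have [measurable]: "(\<lambda>\<theta>. K *v \<theta>) \<in> borel_measurable borel"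
    by (intro borel_measurable_continuous_onI linear_continuous_on linear_linear matrix_vector_mul_linear
        matrix_vector_mul_bounded_linear)
  have R_meas: "R \<in> borel_measurable borel"
    unfolding R_def by measurable
  \<comment> \<open>Completion of the square at \<open>\<phi> *\<^sub>R b + \<theta>\<close>: the
    mixed term \<open>2 * \<phi> * (\<theta> \<bullet> kv)\<close> is absorbed, leaving
    \<open>\<phi>\<^sup>2 * (c - kv \<bullet> b)\<close>, and the phase
    \<open>\<theta> \<bullet> y\<close> leaves \<open>- (\<phi> * (b \<bullet> y))\<close>.\<close>
  have square: "G \<theta> * iexp (\<theta> \<bullet> y) * (CLINT p|M. iexp (- (\<phi> * g p)) * iexp (- (\<theta> \<bullet> f p)))
      = E \<phi> * R (\<phi> *\<^sub>R b + \<theta>)" for \<theta> \<phi>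
  proof -
    have ch: "(CLINT p|M. iexp (- (\<phi> * g p)) * iexp (- (\<theta> \<bullet> f p)))
       = complex_of_real (exp (- (\<theta> \<bullet> (K *v \<theta>) + 2 * \<phi> * (\<theta> \<bullet> kv) + \<phi>\<^sup>2 * c) / 2))"
      using char[of "- \<theta>" "- \<phi>"]
      unfolding iexp_add by (simp add: linear_neg[OF matrix_vector_mul_linear] mult.commute)
    \<comment> \<open>The equation for \<open>b\<close>, with symmetry of \<open>K\<close>, removes
      \<open>K\<close> from every term containing \<open>b\<close>.\<close>
    have bK: "b \<bullet> (K *v b) = kv \<bullet> b - \<tau>\<^sup>2 * (b \<bullet> b)" "b \<bullet> (K *v \<theta>) = kv \<bullet> \<theta> - \<tau>\<^sup>2 * (b \<bullet> \<theta>)"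
      "\<theta> \<bullet> (K *v b) = kv \<bullet> \<theta> - \<tau>\<^sup>2 * (b \<bullet> \<theta>)"
      unfolding K_sym[of b \<theta>] b[symmetric] by (simp_all add: algebra_simps inner_commute K_sym)
    have ex: "- (\<tau>\<^sup>2 * (\<theta> \<bullet> \<theta>)) / 2 + - (\<theta> \<bullet> (K *v \<theta>) + 2 * \<phi> * (\<theta> \<bullet> kv) + \<phi>\<^sup>2 * c) / 2 =
      - (\<phi>\<^sup>2 * (c - kv \<bullet> b)) / 2 + - ((\<phi> *\<^sub>R b + \<theta>) \<bullet> (K *v (\<phi> *\<^sub>R b + \<theta>))
         + \<tau>\<^sup>2 * ((\<phi> *\<^sub>R b + \<theta>) \<bullet> (\<phi> *\<^sub>R b + \<theta>))) / 2"
      by (simp add: matrix_vector_right_distrib matrix_vector_mult_scaleR inner_add_left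
          inner_add_right bK inner_commute[of \<theta> kv] inner_commute[of \<theta> b])
         (simp add: field_simps power2_eq_square)
    have ix: "iexp (\<theta> \<bullet> y) = iexp (- (\<phi> * (b \<bullet> y))) * iexp ((\<phi> *\<^sub>R b + \<theta>) \<bullet> y)"
      by (simp add: exp_add[symmetric] algebra_simps)
    let ?P = "CLINT p|M. iexp (- (\<phi> * g p)) * iexp (- (\<theta> \<bullet> f p))"
    have GP: "G \<theta> * (CLINT p|M. iexp (- (\<phi> * g p)) * iexp (- (\<theta> \<bullet> f p)))
       = complex_of_real (exp (- (\<phi>\<^sup>2 * (c - kv \<bullet> b)) / 2)) *
         complex_of_real (exp (- ((\<phi> *\<^sub>R b + \<theta>) \<bullet> (K *v (\<phi> *\<^sub>R b + \<theta>))
         + \<tau>\<^sup>2 * ((\<phi> *\<^sub>R b + \<theta>) \<bullet> (\<phi> *\<^sub>R b + \<theta>))) / 2))"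
      unfolding ch unfolding G_def of_real_mult[symmetric] exp_add[symmetric] ex ..
    have "G \<theta> * iexp (\<theta> \<bullet> y) * ?P = (G \<theta> * ?P) * iexp (\<theta> \<bullet> y)"
      by (simp only: mult_ac)
    then show ?thesis
      unfolding GP E_def R_def ix by (simp only: mult_ac)
  qed
  have H: "?N * H \<phi> = E \<phi> * (CLINT \<theta>|lborel. R \<theta>)" for \<phi>
  proof -
    have "?N * H \<phi> = (CLINT p|M. iexp (- (\<phi> * g p)) *
        (CLINT \<theta>|lborel. G \<theta> * iexp (\<theta> \<bullet> (y - f p))))"
      unfolding H_def D by (subst integral_mult_right_zero[symmetric]) (simp only: mult_ac)
    also have "\<dots> = (CLINT \<theta>|lborel. G \<theta> * iexp (\<theta> \<bullet> y) *
        (CLINT p|M. iexp (- (\<phi> * g p)) * iexp (- (\<theta> \<bullet> f p))))"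
      by (rule expectation_fourier[where C = 1])
         (use gauss_vec_fourier(1)[OF \<tau>] in \<open>auto simp: G_def[abs_def]\<close>)
    also have "\<dots> = E \<phi> * (CLINT \<theta>|lborel. R (\<phi> *\<^sub>R b + \<theta>))"
      unfolding square by simp
    also have "(CLINT \<theta>|lborel. R (\<phi> *\<^sub>R b + \<theta>)) = (CLINT \<theta>|lborel. R \<theta>)"
      by (rule integral_lborel_translate[OF R_meas])
    finally show ?thesis .
  qed
  \<comment> \<open>Evaluation at \<open>\<phi> = 0\<close> identifies the integral of
    \<open>R\<close> with \<open>?N * H 0\<close>, so the constant that would carry the determinant
    cancels.\<close>
  have "E 0 = 1"
    by (simp add: E_def)
  then have R0: "(CLINT \<theta>|lborel. R \<theta>) = ?N * H 0"
    using H[of 0] by (simp only: mult_1_left)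
  have "?N \<noteq> 0"
    by simp
  moreover have "?N * H \<phi> = ?N * (E \<phi> * H 0)" for \<phi>
    using H[of \<phi>] unfolding R0 by (simp only: mult_ac)
  ultimately have "H \<phi> = E \<phi> * H 0" for \<phi>
    by (metis mult_left_cancel)
  moreover have "H 0 = complex_of_real (LINT p|M. D p)"
    unfolding H_def by simp
  ultimately have H': "H \<phi> = E \<phi> * complex_of_real (LINT p|M. D p)" for \<phi>
    by simp
  \<comment> \<open>The same exchange in the single frequency \<open>\<phi>\<close>, with the
    bounded weight \<open>D\<close>, expresses the joint density through \<open>H\<close>.\<close>
  have "2 * pi * complex_of_real (LINT p|M. D p * normal_density (g p) \<tau> v)
      = (CLINT p|M. complex_of_real (D p) * (CLBINT \<phi>. G1 \<phi> * iexp (\<phi> \<bullet> (v - g p))))"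
    unfolding G1_def inner_real_def integral_gauss_iexp[OF \<tau>2(1)] \<tau>2(2)
    by (simp add: shift0[of "g p" for p] mult_ac
        flip: integral_complex_of_real integral_mult_right_zero)
  also have "\<dots> = (CLBINT \<phi>. G1 \<phi> * iexp (\<phi> \<bullet> v) *
      (CLINT p|M. complex_of_real (D p) * iexp (- (\<phi> \<bullet> g p))))"
  proof (rule expectation_fourier)
    show "integrable lborel G1"
      using integrable_gauss_iexp[OF \<tau>2(1), of 0] by (simp add: G1_def[abs_def])
    show "cmod (complex_of_real (D p)) \<le> (1 / sqrt (2 * pi * \<tau>\<^sup>2)) ^ CARD('n)" for p
      unfolding D_def using prod_normal_density_le[OF \<tau>]
      by (simp add: abs_of_nonneg prod_nonneg normal_density_nonneg del: of_real_prod)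
  qed measurable
  also have "\<dots> = (CLBINT \<phi>. complex_of_real (LINT p|M. D p) *
      (complex_of_real (exp (- (s * \<phi>\<^sup>2) / 2)) * iexp (\<phi> * (v - b \<bullet> y))))"
  proof (rule Bochner_Integration.integral_cong[OF refl])
    fix \<phi>
    \<comment> \<open>The noise variance from \<open>G1\<close> and the variance from
      \<open>E\<close> add up to \<open>s\<close>.\<close>
    have "- (\<tau>\<^sup>2 * \<phi>\<^sup>2) / 2 + - (\<phi>\<^sup>2 * (c - kv \<bullet> b)) / 2 = - (s * \<phi>\<^sup>2) / 2"
      unfolding s(2) by (simp add: field_simps)
    then have G1E: "complex_of_real (exp (- (s * \<phi>\<^sup>2) / 2))
        = G1 \<phi> * complex_of_real (exp (- (\<phi>\<^sup>2 * (c - kv \<bullet> b)) / 2))"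
      unfolding G1_def of_real_mult[symmetric] exp_add[symmetric] by simp
    have ix: "iexp (\<phi> * (v - b \<bullet> y)) = iexp (\<phi> * v) * iexp (- (\<phi> * (b \<bullet> y)))"
      by (simp add: exp_add[symmetric] algebra_simps)
    show "G1 \<phi> * iexp (\<phi> \<bullet> v) * (CLINT p|M. complex_of_real (D p) * iexp (- (\<phi> \<bullet> g p)))
      = complex_of_real (LINT p|M. D p) *
        (complex_of_real (exp (- (s * \<phi>\<^sup>2) / 2)) * iexp (\<phi> * (v - b \<bullet> y)))"
      using H'[of \<phi>] unfolding H_def inner_real_def G1E ix
      by (simp only: E_def mult_ac)
  qed
  also have "\<dots> = complex_of_real (LINT p|M. D p) * (2 * pi * normal_density 0 (sqrt s) (v - b \<bullet> y))"
    by (subst integral_mult_right_zero, subst integral_gauss_iexp[OF s(1)]) simp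
  finally have "complex_of_real (2 * pi * (LINT p|M. D p * normal_density (g p) \<tau> v))
      = complex_of_real (2 * pi * ((LINT p|M. D p) * normal_density (b \<bullet> y) (sqrt s) v))"
    by (simp add: shift0[of "b \<bullet> y"] mult_ac)
  then show ?thesis
    unfolding of_real_eq_iff by (simp add: D_def[abs_def])
qed

section \<open>From the joint law on boxes to a conditional density\<close>

text \<open>The joint law is prescribed on boxes as \<open>h y\<close> times the law with density
  \<open>q y\<close>. Boxes generate the Borel sets, so this fixes the integrals over all events
  determined by \<open>Y\<close>, which characterise the conditional expectation; no quotient by
  \<open>h\<close> is formed.\<close>

lemma (in prob_space) conditional_densityI:
  fixes Y :: "'a \<Rightarrow> real^'n" and Z :: "'a \<Rightarrow> real" and h :: "real^'n \<Rightarrow> real"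
  assumes [measurable]: "Y \<in> borel_measurable M" "Z \<in> borel_measurable M"
    "h \<in> borel_measurable borel"
    and meas: "(\<lambda>(y, v). q y v) \<in> borel_measurable (borel \<Otimes>\<^sub>M borel)"
    and nonneg: "\<And>y v. q y v \<ge> 0"
    and total: "\<And>y. (\<integral>\<^sup>+ v. ennreal (q y v) \<partial>lborel) = 1"
    and boxes: "\<And>B Bs. (\<And>i. B i \<in> sets borel) \<Longrightarrow> Bs \<in> sets borel \<Longrightarrow>
      emeasure M {p \<in> space M. (\<forall>i. Y p $ i \<in> B i) \<and> Z p \<in> Bs} =
      (\<integral>\<^sup>+ y. (\<Prod>i\<in>UNIV. indicator (B i) (y $ i)) * ennreal (h y) *
        (\<integral>\<^sup>+ v. ennreal (q y v) * indicator Bs v \<partial>lborel) \<partial>lborel)"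
  shows "conditional_density M Y Z q"
proof -
  have [measurable]: "(\<lambda>x. q (a x) (b x)) \<in> borel_measurable N"
    if "a \<in> borel_measurable N" "b \<in> borel_measurable N" for a b and N :: "'z measure"
    using measurable_compose[OF measurable_Pair[OF that] meas] by simp
  define Q where "Q Bs y = (\<integral>\<^sup>+ v. ennreal (q y v) * indicator Bs v \<partial>lborel)" for Bs y
  have Q_meas [measurable]: "Q Bs \<in> borel_measurable borel" if [measurable]: "Bs \<in> sets borel" for Bs
    unfolding Q_def by measurable
  have Q_le: "Q Bs y \<le> 1" for Bs y
    unfolding Q_def total[of y, symmetric]
    by (intro nn_integral_mono) (auto simp: indicator_def)
  \<comment> \<open>For fixed \<open>Bs\<close> both sides are measures in \<open>y\<close> alone.
    They agree on the intersection-stable family of open boxes, and growing cubes of finite measure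
    exhaust the space.\<close>
  have joint: "distr (density M (indicator {p \<in> space M. Z p \<in> Bs})) borel Y
      = density lborel (\<lambda>y. ennreal (h y) * Q Bs y)" if Bs [measurable]: "Bs \<in> sets borel" for Bs
  proof (rule measure_eqI_generator_eq)
    let ?E = "range (\<lambda>(a, b). box a b :: (real^'n) set)"
    let ?L = "distr (density M (indicator {p \<in> space M. Z p \<in> Bs})) borel Y"
    show "Int_stable ?E"
      by (auto simp: Int_stable_def box_Int_box)
    show "?E \<subseteq> Pow UNIV" "sets ?L = sigma_sets UNIV ?E"
      "sets (density lborel (\<lambda>y. ennreal (h y) * Q Bs y)) = sigma_sets UNIV ?E"
      by (simp_all add: borel_eq_box)
    have L: "emeasure ?L A = emeasure M {p \<in> space M. Y p \<in> A \<and> Z p \<in> Bs}"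
      if [measurable]: "A \<in> sets borel" for A
    proof -
      have "emeasure ?L A = (\<integral>\<^sup>+ p. indicator {p \<in> space M. Z p \<in> Bs} p *
          indicator (Y -` A \<inter> space M) p \<partial>M)"
        by (subst emeasure_distr) (auto simp: emeasure_density)
      also have "\<dots> = (\<integral>\<^sup>+ p. indicator {p \<in> space M. Y p \<in> A \<and> Z p \<in> Bs} p \<partial>M)"
        by (intro nn_integral_cong) (auto simp: indicator_def)
      finally show ?thesis
        by simp
    qed
    show "emeasure ?L A = emeasure (density lborel (\<lambda>y. ennreal (h y) * Q Bs y)) A" if "A \<in> ?E" for A
    proof -
      from that obtain lu where "A = (case lu of (l, u) \<Rightarrow> box l u)"
        by (rule imageE)
      then obtain l u where A: "A = box l u"
        by (cases lu) simp
      have ind: "(\<Prod>i\<in>UNIV. indicator {l $ i<..<u $ i} (y $ i)) = (indicator A y :: ennreal)" for y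
        by (auto simp: A indicator_def mem_box_cart)
      have "emeasure ?L A = emeasure M {p \<in> space M. Y p \<in> A \<and> Z p \<in> Bs}"
        by (rule L) (simp add: A)
      also have "\<dots> = emeasure M {p \<in> space M. (\<forall>i. Y p $ i \<in> {l $ i<..<u $ i}) \<and> Z p \<in> Bs}"
        by (simp add: A mem_box_cart)
      also have "\<dots> = (\<integral>\<^sup>+ y. ennreal (h y) * Q Bs y * indicator A y \<partial>lborel)"
        by (subst boxes) (simp_all add: ind Q_def mult_ac)
      finally show ?thesis
        by (subst emeasure_density) (simp_all add: A)
    qed
    let ?C = "\<lambda>n::nat. box (- (real n *\<^sub>R One)) (real n *\<^sub>R One) :: (real^'n) set"
    show "range ?C \<subseteq> ?E" "(\<Union>n. ?C n) = UNIV"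
      by (auto simp: UN_box_eq_UNIV)
    show "emeasure ?L (?C n) \<noteq> \<infinity>" for n
      by (subst L) simp_all
  qed
  \<comment> \<open>The case \<open>Bs = UNIV\<close>, where \<open>total\<close> makes the inner
    integral 1: \<open>h\<close> is the marginal density of \<open>Y\<close>.\<close>
  have law: "distr M borel Y = density lborel (\<lambda>y. ennreal (h y))"
  proof -
    have "density M (indicator {p \<in> space M. Z p \<in> UNIV}) = density M (\<lambda>_. 1)"
      by (intro density_cong) auto
    then show ?thesis
      using joint[of UNIV] total by (simp add: Q_def density_1)
  qed
  let ?F = "vimage_algebra (space M) Y borel"
  have sub: "subalgebra M ?F"
    unfolding subalgebra_def by (auto simp: sets_vimage_algebra2)
  interpret S: finite_measure_subalgebra M ?F
    by unfold_locales (rule sub)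
  define r where "r B y = (LINT v:B|lborel. q y v)" for B y
  \<comment> \<open>The bound \<open>Q B y \<le> 1\<close> excludes infinity, so passing between
    extended and ordinary reals loses nothing.\<close>
  have r_Q: "r B y = enn2real (Q B y)" and Q_r: "Q B y = ennreal (r B y)"
    if [measurable]: "B \<in> sets borel" for B y
  proof -
    have "r B y = enn2real (\<integral>\<^sup>+ v. ennreal (indicator B v * q y v) \<partial>lborel)"
      unfolding r_def set_lebesgue_integral_def
      by (subst integral_eq_nn_integral) (auto simp: nonneg)
    also have "(\<integral>\<^sup>+ v. ennreal (indicator B v * q y v) \<partial>lborel) = Q B y"
      unfolding Q_def by (intro nn_integral_cong) (auto simp: indicator_def)
    finally show "r B y = enn2real (Q B y)" .
    then show "Q B y = ennreal (r B y)"
      using Q_le[of B y] by (auto simp: ennreal_enn2real_if top_unique)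
  qed
  have cond: "AE p in M. real_cond_exp M ?F (indicator {p \<in> space M. Z p \<in> B}) p = r B (Y p)"
    if B [measurable]: "B \<in> sets borel" for B
  proof (rule S.real_cond_exp_charact)
    have bd: "0 \<le> r B y" "r B y \<le> 1" for y
      using Q_le[of B y] by (auto simp: r_Q intro: enn2real_leI)
    have qm [measurable]: "r B \<in> borel_measurable borel"
      unfolding r_Q[OF B] by measurable
    show int: "integrable M (\<lambda>p. r B (Y p))"
      by (rule integrable_const_bound[of _ 1]) (use bd in auto)
    show "(\<lambda>p. r B (Y p)) \<in> borel_measurable ?F"
      by (rule measurable_compose[OF measurable_vimage_algebra1 qm]) simp
    show int_ind: "integrable M (indicat_real {p \<in> space M. Z p \<in> B})"
      by (simp add: emeasure_eq_measure)
    fix A assume "A \<in> sets ?F"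
    then obtain C where A: "A = Y -` C \<inter> space M" and C [measurable]: "C \<in> sets borel"
      by (auto simp: sets_vimage_algebra2)
    have A_meas [measurable]: "A \<in> sets M"
      unfolding A by measurable
    have "ennreal (LINT p:A|M. indicat_real {p \<in> space M. Z p \<in> B} p)
        = (\<integral>\<^sup>+ p. ennreal (indicator A p * indicator {p \<in> space M. Z p \<in> B} p) \<partial>M)"
      unfolding set_lebesgue_integral_def real_scaleR_def
      by (rule nn_integral_eq_integral[symmetric])
         (use integrable_real_mult_indicator[OF A_meas int_ind] in \<open>auto simp: mult.commute\<close>)
    also have "\<dots> = (\<integral>\<^sup>+ p. indicator {p \<in> space M. Z p \<in> B} p * indicator A p \<partial>M)"
      by (intro nn_integral_cong) (auto simp: indicator_def)
    also have "\<dots> = emeasure (distr (density M (indicator {p \<in> space M. Z p \<in> B})) borel Y) C"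
      by (subst emeasure_distr) (auto simp: emeasure_density A)
    also have "\<dots> = (\<integral>\<^sup>+ y. Q B y * indicator C y \<partial>distr M borel Y)"
      unfolding joint[OF B] law
      by (subst emeasure_density, simp_all, subst nn_integral_density) (auto simp: mult_ac)
    also have "\<dots> = (\<integral>\<^sup>+ p. ennreal (indicator A p * r B (Y p)) \<partial>M)"
      by (subst nn_integral_distr)
         (auto simp: A Q_r[OF B] indicator_def intro!: nn_integral_cong)
    also have "\<dots> = ennreal (LINT p:A|M. r B (Y p))"
      unfolding set_lebesgue_integral_def real_scaleR_def
      by (rule nn_integral_eq_integral)
         (use bd integrable_real_mult_indicator[OF A_meas int] in \<open>auto simp: mult.commute\<close>)
    finally show "(LINT p:A|M. indicat_real {p \<in> space M. Z p \<in> B} p) = (LINT p:A|M. r B (Y p))"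
      using bd by (subst (asm) ennreal_inj) (auto simp: set_lebesgue_integral_def)
  qed
  show ?thesis
    unfolding conditional_density_def using meas nonneg total cond[unfolded r_def] by auto
qed

section \<open>Linear functionals of the Gaussian process\<close>

lemma (in prob_space) integrable_mult_of_square_integrable:
  fixes X Z :: "'a \<Rightarrow> real"
  assumes [measurable]: "X \<in> borel_measurable M" "Z \<in> borel_measurable M"
    and "integrable M (\<lambda>p. (X p)\<^sup>2)" "integrable M (\<lambda>p. (Z p)\<^sup>2)"
  shows "integrable M (\<lambda>p. X p * Z p)"
proof (rule Bochner_Integration.integrable_bound)
  show "integrable M (\<lambda>p. (X p)\<^sup>2 + (Z p)\<^sup>2)"
    using assms by simp
  have "\<bar>x * z\<bar> \<le> x\<^sup>2 + z\<^sup>2" for x z :: real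
    using sum_squares_bound[of "\<bar>x\<bar>" "\<bar>z\<bar>"] mult_nonneg_nonneg[OF abs_ge_zero[of x] abs_ge_zero[of z]]
    unfolding abs_mult power2_abs by linarith
  then show "AE p in M. norm (X p * Z p) \<le> norm ((X p)\<^sup>2 + (Z p)\<^sup>2)"
    by simp
qed simp

text \<open>Distinct indices may share a task, while joint Gaussianity is indexed by a set of tasks;
  coefficients are therefore summed over the fibres of \<open>t\<close>. In the second moment
  isotropy removes all terms with \<open>s \<noteq> r\<close>, which leaves
  \<open>u j \<bullet> u l\<close>.\<close>

lemma (in prob_space) gaussian_process_linear:
  fixes u :: "'j \<Rightarrow> real^'m" and t :: "'j \<Rightarrow> 't" and W :: "'t \<Rightarrow> 'a \<Rightarrow> real^'m"
  assumes gp: "gaussian_process M T (\<lambda>_. 0) (isotropic_kernel k) W"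
    and J: "finite J" "t ` J \<subseteq> T"
  shows "gaussian_rv M (\<lambda>p. \<Sum>j\<in>J. u j \<bullet> W (t j) p)"
    and "expectation (\<lambda>p. \<Sum>j\<in>J. u j \<bullet> W (t j) p) = 0"
    and "expectation (\<lambda>p. (\<Sum>j\<in>J. u j \<bullet> W (t j) p)\<^sup>2)
      = (\<Sum>j\<in>J. \<Sum>l\<in>J. (u j \<bullet> u l) * k (t j) (t l))"
proof -
  have jg: "jointly_gaussian M (F \<times> UNIV) (\<lambda>(t, s) p. W t p $ s)" if "finite F" "F \<subseteq> T" for F
    using gp that by (simp add: gaussian_process_def)
  have jg_sum: "gaussian_rv M (\<lambda>p. \<Sum>r\<in>F. \<Sum>s\<in>UNIV. a r s * W r p $ s)"
    if "finite F" "F \<subseteq> T" for F a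
  proof -
    have "gaussian_rv M (\<lambda>p. \<Sum>i\<in>F \<times> UNIV. case_prod a i * (case i of (t, s) \<Rightarrow> \<lambda>p. W t p $ s) p)"
      using jg[OF that] unfolding jointly_gaussian_def by blast
    then show ?thesis
      by (simp add: sum.cartesian_product case_prod_beta)
  qed
  have "(\<Sum>r\<in>t ` J. \<Sum>s\<in>UNIV. (\<Sum>j\<in>{j \<in> J. t j = r}. u j $ s) * W r p $ s)
      = (\<Sum>j\<in>J. u j \<bullet> W (t j) p)" for p
  proof -
    have "(\<Sum>r\<in>t ` J. \<Sum>s\<in>UNIV. (\<Sum>j\<in>{j \<in> J. t j = r}. u j $ s) * W r p $ s)
        = (\<Sum>r\<in>t ` J. \<Sum>j\<in>{j \<in> J. t j = r}. u j \<bullet> W (t j) p)"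
    proof (rule sum.cong[OF refl])
      fix r
      have "(\<Sum>s\<in>UNIV. (\<Sum>j\<in>{j \<in> J. t j = r}. u j $ s) * W r p $ s)
          = (\<Sum>j\<in>{j \<in> J. t j = r}. \<Sum>s\<in>UNIV. u j $ s * W r p $ s)"
        by (subst sum.swap) (simp add: sum_distrib_right)
      then show "(\<Sum>s\<in>UNIV. (\<Sum>j\<in>{j \<in> J. t j = r}. u j $ s) * W r p $ s)
          = (\<Sum>j\<in>{j \<in> J. t j = r}. u j \<bullet> W (t j) p)"
        by (simp add: inner_vec_def)
    qed
    also have "\<dots> = (\<Sum>j\<in>J. u j \<bullet> W (t j) p)"
      by (rule sum.image_gen[OF J(1), symmetric])
    finally show ?thesis .
  qed
  then show "gaussian_rv M (\<lambda>p. \<Sum>j\<in>J. u j \<bullet> W (t j) p)"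
    using jg_sum[of "t ` J" "\<lambda>r s. \<Sum>j\<in>{j \<in> J. t j = r}. u j $ s"] J by simp
  have mean: "expectation (\<lambda>p. W r p $ s) = 0" if "r \<in> T" for r s
    using gp that by (simp add: gaussian_process_def)
  \<comment> \<open>A single coordinate is the linear combination over the task set
    \<open>{r}\<close> with a 0-1 coefficient vector.\<close>
  have comp: "gaussian_rv M (\<lambda>p. W r p $ s)" if "r \<in> T" for r s
  proof -
    have "(\<Sum>i\<in>UNIV. (if i = s then 1 else 0) * W r p $ i) = W r p $ s" for p
      by (simp add: if_distrib[of "\<lambda>x. x * _"] cong: if_cong)
    then show ?thesis
      using jg_sum[of "{r}" "\<lambda>_ i. if i = s then 1 else 0"] that by simp
  qed
  have meas: "(\<lambda>p. W r p $ s) \<in> borel_measurable M" if "r \<in> T" for r s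
    using comp[OF that] by (simp add: gaussian_rv_def)
  \<comment> \<open>Finite second moments make coordinates and their products integrable, so that
    the expectation may be taken termwise, which the default value 0 of a Bochner integral would not
    justify.\<close>
  have sq: "integrable M (\<lambda>p. (W r p $ s)\<^sup>2)" if "r \<in> T" for r s
    by (rule gaussian_rv_centered(1)[OF comp[OF that] mean[OF that]])
  have int: "integrable M (\<lambda>p. W r p $ s)" if "r \<in> T" for r s
    by (rule square_integrable_imp_integrable[OF meas[OF that] sq[OF that]])
  have int2: "integrable M (\<lambda>p. W r p $ s * W r' p $ s')" if "r \<in> T" "r' \<in> T" for r r' s s'
    by (rule integrable_mult_of_square_integrable) (use that meas sq in auto)
  have cov: "expectation (\<lambda>p. W r p $ s * W r' p $ s') = (if s = s' then k r r' else 0)"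
    if "r \<in> T" "r' \<in> T" for r r' s s'
  proof -
    have "covariance M (\<lambda>p. W r p $ s) (\<lambda>p. W r' p $ s') = isotropic_kernel k r r' $ s $ s'"
      using gp that by (simp add: gaussian_process_def)
    then show ?thesis
      unfolding covariance_def mean[OF that(1)] mean[OF that(2)]
      by (simp add: isotropic_kernel_def mat_def)
  qed
  have tT: "t j \<in> T" if "j \<in> J" for j
    using that J by auto
  show "expectation (\<lambda>p. \<Sum>j\<in>J. u j \<bullet> W (t j) p) = 0"
    unfolding inner_vec_def using int tT mean by simp
  have "expectation (\<lambda>p. (\<Sum>j\<in>J. u j \<bullet> W (t j) p)\<^sup>2)
     = expectation (\<lambda>p. \<Sum>j\<in>J. \<Sum>l\<in>J. \<Sum>s\<in>UNIV. \<Sum>r\<in>UNIV.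
         (u j $ s * u l $ r) * (W (t j) p $ s * W (t l) p $ r))"
    by (simp add: power2_eq_square sum_product inner_vec_def mult_ac)
  also have "\<dots> = (\<Sum>j\<in>J. \<Sum>l\<in>J. \<Sum>s\<in>UNIV. \<Sum>r\<in>UNIV.
         (u j $ s * u l $ r) * (if s = r then k (t j) (t l) else 0))"
    using int2 tT by (simp add: Bochner_Integration.integral_sum cov)
  also have "\<dots> = (\<Sum>j\<in>J. \<Sum>l\<in>J. (u j \<bullet> u l) * k (t j) (t l))"
    by (simp add: inner_vec_def sum_distrib_right if_distrib[of "\<lambda>x. _ * x"] cong: if_cong)
  finally show "expectation (\<lambda>p. (\<Sum>j\<in>J. u j \<bullet> W (t j) p)\<^sup>2)
      = (\<Sum>j\<in>J. \<Sum>l\<in>J. (u j \<bullet> u l) * k (t j) (t l))" .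
qed

section \<open>The joint law of the labels\<close>

text \<open>Everything is nonnegative, so Tonelli exchanges the integrals once the product over
  training labels has become one integral over \<open>real^'n\<close>. Boundedness of normal
  densities turns the inner expectation into an ordinary integral.\<close>

lemma (in prob_space) nn_integral_box_normal:
  fixes f :: "'a \<Rightarrow> real^'n" and g :: "'a \<Rightarrow> real"
  assumes [measurable]: "f \<in> borel_measurable M" "g \<in> borel_measurable M"
    and B [measurable]: "\<And>i. B i \<in> sets borel" "Bs \<in> sets borel" and \<tau>: "\<tau> > 0"
  shows "(\<integral>\<^sup>+ p. (\<Prod>i\<in>UNIV. \<integral>\<^sup>+ y. ennreal (normal_density (f p $ i) \<tau> y) * indicator (B i) y \<partial>lborel) *
      (\<integral>\<^sup>+ v. ennreal (normal_density (g p) \<tau> v) * indicator Bs v \<partial>lborel) \<partial>M)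
    = (\<integral>\<^sup>+ y. (\<Prod>i\<in>UNIV. indicator (B i) (y $ i)) * (\<integral>\<^sup>+ v. ennreal (LINT p|M.
        (\<Prod>i\<in>UNIV. normal_density (f p $ i) \<tau> (y $ i)) * normal_density (g p) \<tau> v) *
        indicator Bs v \<partial>lborel) \<partial>lborel)"
    (is "?lhs = ?rhs")
proof -
  interpret vec: pair_sigma_finite M "lborel :: (real^'n) measure" ..
  interpret line: pair_sigma_finite M "lborel :: real measure" ..
  define D where "D p y = (\<Prod>i\<in>UNIV. normal_density (f p $ i) \<tau> (y $ i))" for p and y :: "real^'n"
  define I where "I y = (\<Prod>i\<in>UNIV. indicator (B i) (y $ i) :: ennreal)" for y :: "real^'n"
  define N where "N p v = normal_density (g p) \<tau> v" for p v
  have [measurable]: "case_prod N \<in> borel_measurable (M \<Otimes>\<^sub>M borel)"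
    unfolding N_def normal_density_def by measurable
  have [measurable]: "N p \<in> borel_measurable borel" for p
    unfolding N_def normal_density_def by measurable
  have [measurable]: "case_prod D \<in> borel_measurable (M \<Otimes>\<^sub>M borel)"
    unfolding D_def normal_density_def by measurable
  have [measurable]: "I \<in> borel_measurable borel"
    unfolding I_def by measurable
  have nonneg: "D p y \<ge> 0" "N p v \<ge> 0" for p y v
    by (simp_all add: D_def N_def prod_nonneg normal_density_nonneg)
  have DN: "ennreal (D p y) * (\<integral>\<^sup>+ v. ennreal (N p v) * indicator Bs v \<partial>lborel)
      = (\<integral>\<^sup>+ v. ennreal (D p y * N p v) * indicator Bs v \<partial>lborel)" for p y
    by (subst nn_integral_cmult[symmetric]) (simp_all add: ennreal_mult nonneg mult_ac)
  have "(\<Prod>i\<in>UNIV. \<integral>\<^sup>+ y. ennreal (normal_density (f p $ i) \<tau> y) * indicator (B i) y \<partial>lborel)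
      = (\<integral>\<^sup>+ y. I y * ennreal (D p y) \<partial>lborel)" for p
    by (subst nn_integral_lborel_vec_prod[symmetric])
       (simp_all add: D_def I_def prod.distrib prod_ennreal mult_ac)
  then have "?lhs = (\<integral>\<^sup>+ p. (\<integral>\<^sup>+ y. I y * ennreal (D p y) \<partial>lborel) *
      (\<integral>\<^sup>+ v. ennreal (N p v) * indicator Bs v \<partial>lborel) \<partial>M)"
    by (simp add: N_def)
  also have "\<dots> = (\<integral>\<^sup>+ p. \<integral>\<^sup>+ y. I y * (ennreal (D p y) *
      (\<integral>\<^sup>+ v. ennreal (N p v) * indicator Bs v \<partial>lborel)) \<partial>lborel \<partial>M)"
    by (intro nn_integral_cong, subst nn_integral_multc[symmetric]) (simp_all add: mult_ac)
  also have "\<dots> = (\<integral>\<^sup>+ y. \<integral>\<^sup>+ p. I y * (ennreal (D p y) *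
      (\<integral>\<^sup>+ v. ennreal (N p v) * indicator Bs v \<partial>lborel)) \<partial>M \<partial>lborel)"
    by (rule vec.Fubini'[symmetric]) measurable
  also have "\<dots> = (\<integral>\<^sup>+ y. I y * (\<integral>\<^sup>+ p. \<integral>\<^sup>+ v. ennreal (D p y * N p v) * indicator Bs v \<partial>lborel \<partial>M) \<partial>lborel)"
    unfolding DN by (intro nn_integral_cong, rule nn_integral_cmult) measurable
  also have "\<dots> = (\<integral>\<^sup>+ y. I y * (\<integral>\<^sup>+ v. \<integral>\<^sup>+ p. ennreal (D p y * N p v) * indicator Bs v \<partial>M \<partial>lborel) \<partial>lborel)"
    by (intro nn_integral_cong arg_cong2[where f = "(*)"] refl line.Fubini'[symmetric]) measurable
  also have "\<dots> = (\<integral>\<^sup>+ y. I y * (\<integral>\<^sup>+ v. ennreal (LINT p|M. D p y * N p v) * indicator Bs v \<partial>lborel) \<partial>lborel)"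
  proof -
    have int: "integrable M (\<lambda>p. D p y * N p v)" for y v
    proof (rule integrable_const_bound)
      have "D p y * N p v \<le> (1 / sqrt (2 * pi * \<tau>\<^sup>2)) ^ CARD('n) * (1 / sqrt (2 * pi * \<tau>\<^sup>2))" for p
        using prod_normal_density_le[OF \<tau>] normal_density_le[OF \<tau>] nonneg
        by (intro mult_mono) (simp_all add: D_def N_def)
      then show "AE p in M. norm (D p y * N p v)
          \<le> (1 / sqrt (2 * pi * \<tau>\<^sup>2)) ^ CARD('n) * (1 / sqrt (2 * pi * \<tau>\<^sup>2))"
        by (simp add: nonneg abs_mult)
    qed measurable
    have "(\<integral>\<^sup>+ p. ennreal (D p y * N p v) * indicator Bs v \<partial>M)
        = ennreal (LINT p|M. D p y * N p v) * indicator Bs v" for y v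
      by (subst nn_integral_multc) (simp_all add: nn_integral_eq_integral[OF int] nonneg)
    then show ?thesis
      by simp
  qed
  finally show ?thesis
    by (simp add: D_def I_def N_def)
qed

text \<open>Tower property: the probability of the label event is the expectation of its conditional
  probability given the process, which the model prescribes.\<close>

lemma (in prob_space) emeasure_labels:
  fixes Y :: "'a \<Rightarrow> real^'n" and W :: "'t \<Rightarrow> 'a \<Rightarrow> real^'m"
  assumes labels: "labels_given_process M T W obs X t xs ts Y Ys"
    and W: "\<And>r. r \<in> T \<Longrightarrow> W r \<in> borel_measurable M"
    and obs: "\<And>x w. obs x w = normal_density (x \<bullet> w) \<tau>" and \<tau>: "\<tau> > 0"
    and B: "\<And>i. B i \<in> sets borel" "Bs \<in> sets borel"
  shows "emeasure M {p \<in> space M. (\<forall>i. Y p $ i \<in> B i) \<and> Ys p \<in> Bs} =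
    (\<integral>\<^sup>+ p. (\<Prod>i\<in>UNIV. \<integral>\<^sup>+ y. ennreal (normal_density (X $ i \<bullet> W (t i) p) \<tau> y) * indicator (B i) y \<partial>lborel) *
      (\<integral>\<^sup>+ v. ennreal (normal_density (xs \<bullet> W ts p) \<tau> v) * indicator Bs v \<partial>lborel) \<partial>M)"
proof -
  have [measurable]: "Y \<in> borel_measurable M" "Ys \<in> borel_measurable M"
    using labels by (auto simp: labels_given_process_def)
  note B[measurable]
  let ?F = "process_algebra M T W"
  let ?S = "{p \<in> space M. (\<forall>i. Y p $ i \<in> B i) \<and> Ys p \<in> Bs}"
  let ?c = "\<lambda>m A. (LINT y:A|lborel. normal_density m \<tau> y)"
  have process: "(\<lambda>p. \<lambda>r\<in>T. W r p) \<in> measurable M (\<Pi>\<^sub>M r\<in>T. borel)"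
    by (rule measurable_restrict) (rule W)
  have "(\<lambda>p. \<lambda>r\<in>T. W r p) \<in> space M \<rightarrow> space (\<Pi>\<^sub>M r\<in>T. borel)"
    using measurable_space[OF process] by (rule funcsetI)
  \<comment> \<open>Measurability of every \<open>W r\<close> with \<open>r \<in> T\<close> places
    the generated sigma-algebra inside that of \<open>M\<close>.\<close>
  then have "subalgebra M ?F"
    unfolding subalgebra_def process_algebra_def
    by (auto simp: sets_vimage_algebra2 intro!: measurable_sets[OF process])
  then interpret S: finite_measure_subalgebra M ?F
    by unfold_locales
  have S_meas [measurable]: "?S \<in> sets M"
    by measurable
  have AE: "AE p in M. real_cond_exp M ?F (indicator ?S) p =
      (\<Prod>i\<in>UNIV. ?c (X $ i \<bullet> W (t i) p) (B i)) * ?c (xs \<bullet> W ts p) Bs"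
    by (rule labels[unfolded labels_given_process_def obs, THEN conjunct2, THEN conjunct2,
          rule_format, of B Bs]) (simp add: B)
  have c: "ennreal (?c m A) = (\<integral>\<^sup>+ y. ennreal (normal_density m \<tau> y) * indicator A y \<partial>lborel)"
    and c_nonneg: "?c m A \<ge> 0" if [measurable]: "A \<in> sets borel" for m A
  proof -
    have int: "integrable lborel (\<lambda>y. indicator A y * normal_density m \<tau> y)"
      using integrable_real_mult_indicator[of A lborel "normal_density m \<tau>"] \<tau>
      by (simp add: mult.commute)
    have "ennreal (?c m A) = (\<integral>\<^sup>+ y. ennreal (indicator A y * normal_density m \<tau> y) \<partial>lborel)"
      unfolding set_lebesgue_integral_def real_scaleR_def
      by (rule nn_integral_eq_integral[symmetric]) (auto simp: int normal_density_nonneg)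
    also have "\<dots> = (\<integral>\<^sup>+ y. ennreal (normal_density m \<tau> y) * indicator A y \<partial>lborel)"
      by (intro nn_integral_cong) (auto simp: indicator_def)
    finally show "ennreal (?c m A) = (\<integral>\<^sup>+ y. ennreal (normal_density m \<tau> y) * indicator A y \<partial>lborel)" .
    show "?c m A \<ge> 0"
      unfolding set_lebesgue_integral_def
      by (intro Bochner_Integration.integral_nonneg) (auto simp: normal_density_nonneg)
  qed
  have int_S: "integrable M (indicat_real ?S)"
    by (simp add: emeasure_eq_measure)
  have "emeasure M ?S = ennreal (LINT p|M. indicat_real ?S p)"
    by (simp add: emeasure_eq_measure)
  also have "\<dots> = ennreal (LINT p|M. real_cond_exp M ?F (indicator ?S) p)"
    using S.real_cond_exp_int(2)[OF int_S] by simp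
  also have "\<dots> = (\<integral>\<^sup>+ p. ennreal (real_cond_exp M ?F (indicator ?S) p) \<partial>M)"
  proof (rule nn_integral_eq_integral[symmetric])
    show "integrable M (real_cond_exp M ?F (indicator ?S))"
      by (rule S.real_cond_exp_int(1)[OF int_S])
    show "AE p in M. 0 \<le> real_cond_exp M ?F (indicator ?S) p"
      using AE by eventually_elim (simp add: prod_nonneg c_nonneg)
  qed
  also have "\<dots> = (\<integral>\<^sup>+ p. ennreal ((\<Prod>i\<in>UNIV. ?c (X $ i \<bullet> W (t i) p) (B i)) * ?c (xs \<bullet> W ts p) Bs) \<partial>M)"
    by (rule nn_integral_cong_AE) (use AE in eventually_elim, simp)
  also have "\<dots> = (\<integral>\<^sup>+ p. (\<Prod>i\<in>UNIV. ennreal (?c (X $ i \<bullet> W (t i) p) (B i))) * ennreal (?c (xs \<bullet> W ts p) Bs) \<partial>M)"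
    by (simp add: ennreal_mult prod_nonneg c_nonneg prod_ennreal)
  finally show ?thesis
    by (simp add: c)
qed

section \<open>The predictive distribution\<close>

theorem theorem3:
  fixes M :: "'p measure"
    and T :: "'t set" and k :: "'t \<Rightarrow> 't \<Rightarrow> real"
    and W :: "'t \<Rightarrow> 'p \<Rightarrow> real^'m"
    and \<X> :: "(real^'m) set"
    and X :: "real^'m^'n" and t :: "'n \<Rightarrow> 't" and xs :: "real^'m" and ts :: 't
    and Y :: "'p \<Rightarrow> real^'n" and Ys :: "'p \<Rightarrow> real"
    and \<tau> :: real and obs :: "real^'m \<Rightarrow> real^'m \<Rightarrow> real \<Rightarrow> real"
    and K :: "real^'n^'n" and kv :: "real^'n"
    and \<mu> :: "real^'n \<Rightarrow> real" and \<sigma>2 :: real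
  assumes "prob_space M"
    and "psd_kernel T k"
    and "gaussian_process M T (\<lambda>_. 0) (isotropic_kernel k) W"
    and "\<And>i. X $ i \<in> \<X>" and "xs \<in> \<X>"
    and "\<And>i. t i \<in> T" and "ts \<in> T"
    and "\<tau> > 0"
    and "obs = (\<lambda>x w. normal_pdf (x \<bullet> w) (\<tau>\<^sup>2))"
    and "labels_given_process M T W obs X t xs ts Y Ys"
    and "positive_definite ((\<chi> i j. k (t i) (t j)) :: real^'n^'n)"
    and "K = (\<chi> i j. (X $ i \<bullet> X $ j) * k (t i) (t j))"
    and "kv = (\<chi> i. (X $ i \<bullet> xs) * k (t i) ts)"
    and "\<mu> = (\<lambda>y. kv \<bullet> (matrix_inv (K + \<tau>\<^sup>2 *\<^sub>R mat 1) *v y))"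
    and "\<sigma>2 = (xs \<bullet> xs) * k ts ts - kv \<bullet> (matrix_inv (K + \<tau>\<^sup>2 *\<^sub>R mat 1) *v kv)"
  shows "invertible (K + \<tau>\<^sup>2 *\<^sub>R mat 1) \<and> \<sigma>2 + \<tau>\<^sup>2 > 0 \<and>
    (\<forall>y v. predictive_density M W obs X t xs ts y v = normal_pdf (\<mu> y) (\<sigma>2 + \<tau>\<^sup>2) v) \<and>
    conditional_density M Y Ys (\<lambda>y. normal_pdf (\<mu> y) (\<sigma>2 + \<tau>\<^sup>2))"
proof -
  interpret prob_space M by fact
  note gp = assms(3) and tT = assms(6,7) and \<tau> = assms(8) and labels = assms(10)
  note K_def = assms(12) and kv_def = assms(13) and \<mu>_def = assms(14) and \<sigma>2_def = assms(15)
  have k_sym: "k r r' = k r' r" if "r \<in> T" "r' \<in> T" for r r'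
    using assms(2) that by (simp add: psd_kernel_def)
  have W_meas: "W r \<in> borel_measurable M" if "r \<in> T" for r
    using gp that by (simp add: gaussian_process_def)
  have [measurable]: "W (t i) \<in> borel_measurable M" "W ts \<in> borel_measurable M" for i
    by (simp_all add: W_meas tT)
  have obs: "obs x w = normal_density (x \<bullet> w) \<tau>" for x w
    using \<tau> unfolding assms(9) normal_pdf_def[abs_def] by simp
  define f where "f p = (\<chi> i. X $ i \<bullet> W (t i) p)" for p
  define g where "g p = xs \<bullet> W ts p" for p
  define c where "c = (xs \<bullet> xs) * k ts ts"
  define b where "b = matrix_inv (K + \<tau>\<^sup>2 *\<^sub>R mat 1) *v kv"
  define L where "L y p = (\<Prod>i\<in>UNIV. normal_density (f p $ i) \<tau> (y $ i))" for y :: "real^'n" and p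
  have f_meas [measurable]: "f \<in> borel_measurable M"
    unfolding f_def[abs_def] by (rule borel_measurable_vec_lambda) measurable
  have g_meas [measurable]: "g \<in> borel_measurable M"
    unfolding g_def[abs_def] by measurable
  have char: "(CLINT p|M. iexp (\<theta> \<bullet> f p + \<phi> * g p)) =
      complex_of_real (exp (- (\<theta> \<bullet> (K *v \<theta>) + 2 * \<phi> * (\<theta> \<bullet> kv) + \<phi>\<^sup>2 * c) / 2))" for \<theta> \<phi>
  proof -
    \<comment> \<open>The type \<open>'n option\<close> indexes all points at once:
      \<open>None\<close> is the test point and \<open>Some i\<close> a training point, so one
      linear functional of the process yields
      \<open>\<theta> \<bullet> f p + \<phi> * g p\<close>.\<close>
    define u where "u j = (case j of None \<Rightarrow> \<phi> *\<^sub>R xs | Some i \<Rightarrow> (\<theta> $ i) *\<^sub>R X $ i)" for j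
    define s where "s j = (case j of None \<Rightarrow> ts | Some i \<Rightarrow> t i)" for j
    have sum_option: "(\<Sum>j\<in>UNIV. h j) = h None + (\<Sum>i\<in>UNIV. h (Some i))" for h :: "'n option \<Rightarrow> real"
      by (simp add: UNIV_option_conv sum.reindex)
    have J: "finite (UNIV :: 'n option set)" "s ` UNIV \<subseteq> T"
      using tT by (auto simp: s_def split: option.split)
    note lin = gaussian_process_linear[OF gp J, of u]
    have Z: "(\<Sum>j\<in>UNIV. u j \<bullet> W (s j) p) = \<theta> \<bullet> f p + \<phi> * g p" for p
      unfolding sum_option by (simp add: u_def s_def f_def g_def inner_vec_def[of \<theta>])
    have "(\<Sum>j\<in>UNIV. \<Sum>l\<in>UNIV. (u j \<bullet> u l) * k (s j) (s l))
        = \<phi>\<^sup>2 * c + (\<Sum>i\<in>UNIV. \<phi> * \<theta> $ i * (xs \<bullet> X $ i) * k ts (t i))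
          + (\<Sum>i\<in>UNIV. \<theta> $ i * \<phi> * (X $ i \<bullet> xs) * k (t i) ts)
          + (\<Sum>i\<in>UNIV. \<Sum>l\<in>UNIV. \<theta> $ i * \<theta> $ l * (X $ i \<bullet> X $ l) * k (t i) (t l))"
      unfolding sum_option by (simp add: u_def s_def c_def sum.distrib power2_eq_square mult_ac)
    also have "\<dots> = \<theta> \<bullet> (K *v \<theta>) + 2 * \<phi> * (\<theta> \<bullet> kv) + \<phi>\<^sup>2 * c"
      by (simp add: K_def kv_def inner_vec_def[of \<theta>] matrix_vector_mult_def sum_distrib_left
          k_sym[of ts] tT inner_commute[of xs] mult_ac)
    finally show ?thesis
      using gaussian_rv_centered(2)[OF lin(1,2)] unfolding lin(3) unfolding Z by simp
  qed
  \<comment> \<open>This form is the variance of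
    \<open>\<theta> \<bullet> f p + \<phi> * g p\<close>.\<close>
  have Q: "\<theta> \<bullet> (K *v \<theta>) + 2 * \<phi> * (\<theta> \<bullet> kv) + \<phi>\<^sup>2 * c \<ge> 0" for \<theta> \<phi>
    by (rule char_exponent_nonneg[OF _ char]) measurable
  have K_psd: "\<theta> \<bullet> (K *v \<theta>) \<ge> 0" for \<theta>
    using Q[of \<theta> 0] by simp
  have K_sym: "transpose K = K"
    by (simp add: K_def transpose_def vec_eq_iff inner_commute k_sym tT)
  have \<tau>2: "\<tau>\<^sup>2 > 0"
    using \<tau> by simp
  note A = psd_plus_scaled_identity[OF K_psd K_sym \<tau>2]
  have b: "K *v b + \<tau>\<^sup>2 *\<^sub>R b = kv"
    unfolding b_def by (rule A(2))
  have \<mu>: "\<mu> y = b \<bullet> y" for y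
    unfolding \<mu>_def b_def by (rule A(3))
  have \<sigma>2: "\<sigma>2 = c - kv \<bullet> b"
    by (simp add: \<sigma>2_def c_def b_def)
  have "b \<bullet> (K *v b) = kv \<bullet> b - \<tau>\<^sup>2 * (b \<bullet> b)"
    unfolding b[symmetric] by (simp add: inner_add_left inner_commute[of "K *v b" b])
  \<comment> \<open>The choice \<open>\<theta> = b\<close>, \<open>\<phi> = -1\<close> writes
    \<open>\<sigma>2\<close> as the variance of \<open>b \<bullet> f p - g p\<close> plus the label
    noise passed through \<open>b\<close>: the mean squared error of the linear predictor of
    \<open>g\<close>.\<close>
  then have "\<sigma>2 = (b \<bullet> (K *v b) + 2 * (-1) * (b \<bullet> kv) + (-1)\<^sup>2 * c) + \<tau>\<^sup>2 * (b \<bullet> b)"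
    by (simp add: \<sigma>2 inner_commute)
  also have "\<dots> \<ge> 0"
    by (intro add_nonneg_nonneg Q) simp
  finally have s_pos: "\<sigma>2 + \<tau>\<^sup>2 > 0"
    using \<tau>2 by linarith
  have factor: "(LINT p|M. L y p * normal_density (g p) \<tau> v) = (LINT p|M. L y p) * normal_pdf (\<mu> y) (\<sigma>2 + \<tau>\<^sup>2) v"
    for y v
    unfolding L_def normal_pdf_def \<mu>
    by (rule gaussian_smoothing_factor[OF f_meas g_meas \<tau> s_pos _ K_sym b char]) (simp add: \<sigma>2)
  have L_meas [measurable]: "(\<lambda>(p, y). L y p) \<in> borel_measurable (M \<Otimes>\<^sub>M borel)"
    unfolding L_def normal_density_def by measurable
  have [measurable]: "L y \<in> borel_measurable M" for y
    unfolding L_def[abs_def] normal_density_def by measurable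
  have L_pos: "L y p > 0" for y p
    unfolding L_def by (intro prod_pos normal_density_pos \<tau>)
  have L_int: "integrable M (L y)" for y
    using prod_normal_density_le[OF \<tau>] L_pos[of y]
    by (intro integrable_const_bound[of _ "(1 / sqrt (2 * pi * \<tau>\<^sup>2)) ^ CARD('n)"])
       (auto simp: L_def abs_of_nonneg prod_nonneg normal_density_nonneg)
  \<comment> \<open>The evidence is strictly positive for every \<open>y\<close>, which makes the
    division in Bayes' rule valid pointwise and not only almost everywhere.\<close>
  have EL_pos: "(LINT p|M. L y p) > 0" for y
  proof -
    have "(LINT p|M. L y p) \<noteq> 0"
    proof
      assume "(LINT p|M. L y p) = 0"
      then have "AE p in M. L y p = 0"
        by (subst (asm) integral_nonneg_eq_0_iff_AE[OF L_int]) (simp_all add: less_imp_le[OF L_pos])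
      then have "AE p in M. False"
        by eventually_elim (use L_pos[of y] in \<open>simp add: less_le\<close>)
      then show False
        by simp
    qed
    moreover have "(LINT p|M. L y p) \<ge> 0"
      by (intro Bochner_Integration.integral_nonneg less_imp_le L_pos)
    ultimately show ?thesis
      by simp
  qed
  have pred: "predictive_density M W obs X t xs ts y v = normal_pdf (\<mu> y) (\<sigma>2 + \<tau>\<^sup>2) v" for y v
  proof -
    have tl: "train_likelihood W obs X t y = L y"
      by (simp add: fun_eq_iff train_likelihood_def obs L_def f_def)
    let ?E = "LINT p|M. L y p"
    have "predictive_density M W obs X t xs ts y v
        = (LINT w|distr (density M (\<lambda>p. ennreal (L y p / ?E))) borel (W ts). normal_density (xs \<bullet> w) \<tau> v)"
      by (simp add: predictive_density_def posterior_def tl obs)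
    \<comment> \<open>Pulling the posterior back along \<open>W ts\<close> gives an integral over
      \<open>M\<close> weighted by \<open>L y p / ?E\<close>; after the factorisation the evidence
      cancels.\<close>
    also have "\<dots> = (LINT p|density M (\<lambda>p. ennreal (L y p / ?E)). normal_density (g p) \<tau> v)"
      by (subst integral_distr) (simp_all add: g_def normal_density_def)
    also have "\<dots> = (LINT p|M. (L y p * normal_density (g p) \<tau> v) / ?E)"
      using less_imp_le[OF L_pos] less_imp_le[OF EL_pos]
      by (subst integral_density) (auto simp: normal_density_def)
    also have "\<dots> = normal_pdf (\<mu> y) (\<sigma>2 + \<tau>\<^sup>2) v"
      using EL_pos[of y] by (simp add: factor)
    finally show ?thesis .
  qed
  have sqrt_pos: "sqrt (\<sigma>2 + \<tau>\<^sup>2) > 0"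
    using s_pos by simp
  have "conditional_density M Y Ys (\<lambda>y. normal_pdf (\<mu> y) (\<sigma>2 + \<tau>\<^sup>2))"
  \<comment> \<open>The evidence, as a function of \<open>y\<close>, serves as the marginal density
    of the training labels.\<close>
  proof (rule conditional_densityI[where h = "\<lambda>y. LINT p|M. L y p"])
    show "Y \<in> borel_measurable M" "Ys \<in> borel_measurable M"
      using labels by (auto simp: labels_given_process_def)
    show "(\<lambda>y. LINT p|M. L y p) \<in> borel_measurable borel"
      by measurable
    show "(\<lambda>(y, v). normal_pdf (\<mu> y) (\<sigma>2 + \<tau>\<^sup>2) v) \<in> borel_measurable (borel \<Otimes>\<^sub>M borel)"
      unfolding normal_pdf_def \<mu> normal_density_def by measurable
    show "normal_pdf (\<mu> y) (\<sigma>2 + \<tau>\<^sup>2) v \<ge> 0" for y v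
      by (simp add: normal_pdf_def normal_density_nonneg)
    show "(\<integral>\<^sup>+ v. ennreal (normal_pdf (\<mu> y) (\<sigma>2 + \<tau>\<^sup>2) v) \<partial>lborel) = 1" for y
      unfolding normal_pdf_def
      by (subst nn_integral_eq_integral) (simp_all add: sqrt_pos s_pos normal_density_nonneg)
    fix B :: "'n \<Rightarrow> real set" and Bs :: "real set"
    assume B [measurable]: "\<And>i. B i \<in> sets borel" "Bs \<in> sets borel"
    let ?S = "{p \<in> space M. (\<forall>i. Y p $ i \<in> B i) \<and> Ys p \<in> Bs}"
    have "emeasure M ?S = (\<integral>\<^sup>+ y. (\<Prod>i\<in>UNIV. indicator (B i) (y $ i)) * (\<integral>\<^sup>+ v. ennreal (LINT p|M.
        L y p * normal_density (g p) \<tau> v) * indicator Bs v \<partial>lborel) \<partial>lborel)"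
      using emeasure_labels[OF labels W_meas obs \<tau> B] nn_integral_box_normal[OF f_meas g_meas B \<tau>]
      by (simp add: f_def g_def L_def)
    also have "\<dots> = (\<integral>\<^sup>+ y. (\<Prod>i\<in>UNIV. indicator (B i) (y $ i)) * ennreal (LINT p|M. L y p) *
        (\<integral>\<^sup>+ v. ennreal (normal_pdf (\<mu> y) (\<sigma>2 + \<tau>\<^sup>2) v) * indicator Bs v \<partial>lborel) \<partial>lborel)"
    proof (rule nn_integral_cong)
      fix y :: "real^'n"
      have "(\<integral>\<^sup>+ v. ennreal (LINT p|M. L y p * normal_density (g p) \<tau> v) * indicator Bs v \<partial>lborel)
        = (\<integral>\<^sup>+ v. ennreal (LINT p|M. L y p) *
            (ennreal (normal_pdf (\<mu> y) (\<sigma>2 + \<tau>\<^sup>2) v) * indicator Bs v) \<partial>lborel)"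
        unfolding factor using EL_pos[of y]
        by (simp add: ennreal_mult' mult_ac less_imp_le)
      also have "\<dots> = ennreal (LINT p|M. L y p) *
          (\<integral>\<^sup>+ v. ennreal (normal_pdf (\<mu> y) (\<sigma>2 + \<tau>\<^sup>2) v) * indicator Bs v \<partial>lborel)"
        by (rule nn_integral_cmult) (simp add: normal_pdf_def)
      finally show "(\<Prod>i\<in>UNIV. indicator (B i) (y $ i)) * (\<integral>\<^sup>+ v. ennreal (LINT p|M.
          L y p * normal_density (g p) \<tau> v) * indicator Bs v \<partial>lborel)
        = (\<Prod>i\<in>UNIV. indicator (B i) (y $ i)) * ennreal (LINT p|M. L y p) *
          (\<integral>\<^sup>+ v. ennreal (normal_pdf (\<mu> y) (\<sigma>2 + \<tau>\<^sup>2) v) * indicator Bs v \<partial>lborel)"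
        by (simp only: mult.assoc)
    qed
    finally show "emeasure M ?S = (\<integral>\<^sup>+ y. (\<Prod>i\<in>UNIV. indicator (B i) (y $ i)) *
        ennreal (LINT p|M. L y p) *
        (\<integral>\<^sup>+ v. ennreal (normal_pdf (\<mu> y) (\<sigma>2 + \<tau>\<^sup>2) v) * indicator Bs v \<partial>lborel) \<partial>lborel)" .
  qed
  then show ?thesis
    using A(1) s_pos pred by simp
qed

end
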